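(* \textsc{Colored Clustering} is fixed-parameter tractable with respect to $r-\rho'(G,\ell)$, where $r=|E|-k$ and $\rho'(G,\ell)=\frac12\sum_{v\in V}\min\big(\deg(v)-\max_{c\in C}\deg_c(v),\ \tfrac12\deg(v)\big)$.
   Context: \textsc{Colored Clustering}: given a graph $G=(V,E)$, an edge coloring $\ell\colon E\to C$, and $k\in\mathbb{N}$, decide whether there is a stable $F\subseteq E$ with $|F|\ge k$; $F$ is stable if $\ell(e)=\ell(e')$ whenever $e,e'\in F$ share a vertex. $r:=|E|-k$ is the number of permitted unstable edges. $\deg(v)$ is the number of edges incident to $v$, and $\deg_c(v)$ the number of edges of color $c$ incident to $v$. *)

theory Defs
  imports Complex_Main
begin

section \<open>Random access machines\<close>

text \<open>
  Programs of a random access machine with the uniform cost measure. A store consists of unbounded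
  arrays of natural numbers, named by strings; a program mentions only finitely many of them, and
  the entry with index 0 serves as a scalar variable. Arithmetic is restricted to addition, cut-off
  subtraction and halving. There is no multiplication, so \<open>t\<close> steps lengthen the binary
  representation of the numbers in the store by at most \<open>O(t)\<close> bits; hence the model
  is polynomially equivalent to Turing machines although every step has unit cost.
\<close>

datatype aexp =
    Const nat
  | Get string aexp
  | Add aexp aexp
  | Sub aexp aexp
  | Half aexp

datatype bexp =
    Less aexp aexp
  | Neg bexp
  | Conj bexp bexp

datatype com =
    Skip
  | Put string aexp aexp
  | Seq com com
  | Cond bexp com com
  | While bexp com

type_synonym store = "string \<Rightarrow> nat \<Rightarrow> nat"

fun aval :: "aexp \<Rightarrow> store \<Rightarrow> nat" where
  "aval (Const n) s = n"
| "aval (Get x i) s = s x (aval i s)"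
| "aval (Add a b) s = aval a s + aval b s"
| "aval (Sub a b) s = aval a s - aval b s"
| "aval (Half a) s = aval a s div 2"

fun bval :: "bexp \<Rightarrow> store \<Rightarrow> bool" where
  "bval (Less a b) s \<longleftrightarrow> aval a s < aval b s"
| "bval (Neg b) s \<longleftrightarrow> \<not> bval b s"
| "bval (Conj b c) s \<longleftrightarrow> bval b s \<and> bval c s"

text \<open>
  \<open>exec p s t s'\<close>: started in store \<open>s\<close>, the program \<open>p\<close> halts after \<open>t\<close> steps in store \<open>s'\<close>.
  An assignment or a test is a single step; the expressions occurring in a fixed program
  have constant size, so this differs from counting single operations by a constant factor.
\<close>

inductive exec :: "com \<Rightarrow> store \<Rightarrow> nat \<Rightarrow> store \<Rightarrow> bool" where
  Skip: "exec Skip s 1 s"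
| Put: "exec (Put x i a) s 1 (s(x := (s x)(aval i s := aval a s)))"
| Seq: "exec p s t s' \<Longrightarrow> exec q s' t' s'' \<Longrightarrow> exec (Seq p q) s (t + t') s''"
| CondTrue: "bval b s \<Longrightarrow> exec p s t s' \<Longrightarrow> exec (Cond b p q) s (Suc t) s'"
| CondFalse: "\<not> bval b s \<Longrightarrow> exec q s t s' \<Longrightarrow> exec (Cond b p q) s (Suc t) s'"
| WhileFalse: "\<not> bval b s \<Longrightarrow> exec (While b p) s 1 s"
| WhileTrue: "bval b s \<Longrightarrow> exec p s t s' \<Longrightarrow> exec (While b p) s' t' s'' \<Longrightarrow>
    exec (While b p) s (Suc (t + t')) s''"

inductive_cases exec_SkipE: "exec Skip s t s'"
inductive_cases exec_PutE: "exec (Put x i a) s t s'"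
inductive_cases exec_SeqE: "exec (Seq p q) s t s'"
inductive_cases exec_CondE: "exec (Cond b p q) s t s'"
inductive_cases exec_WhileE: "exec (While b p) s t s'"

lemma exec_deterministic:
  "exec p s t s' \<Longrightarrow> exec p s u s'' \<Longrightarrow> t = u \<and> s' = s''"
proof (induction arbitrary: u s'' rule: exec.induct)
  case Skip then show ?case by (auto elim: exec_SkipE)
next
  case Put then show ?case by (auto elim: exec_PutE)
next
  case Seq from Seq.prems show ?case by (rule exec_SeqE) (use Seq.IH in blast)
next
  case CondTrue from CondTrue.prems show ?case by (rule exec_CondE) (use CondTrue in blast)+
next
  case CondFalse from CondFalse.prems show ?case by (rule exec_CondE) (use CondFalse in blast)+
next
  case WhileFalse from WhileFalse.prems show ?case by (rule exec_WhileE) (use WhileFalse in auto)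
next
  case WhileTrue from WhileTrue.prems show ?case by (rule exec_WhileE) (use WhileTrue in blast)+
qed

text \<open>
  The input word is found in the array \<open>in\<close> and its length in \<open>len\<close>; the result is read off \<open>out\<close>.
\<close>

definition init_store :: "nat list \<Rightarrow> store" where
  "init_store w = (\<lambda>x i.
     if x = ''in'' \<and> i < length w then w ! i
     else if x = ''len'' \<and> i = 0 then length w
     else 0)"

definition result :: "store \<Rightarrow> nat" where
  "result s = s ''out'' 0"

fun bit_length :: "nat \<Rightarrow> nat" where
  "bit_length n = (if n < 2 then 1 else Suc (bit_length (n div 2)))"

declare bit_length.simps [simp del]

definition word_size :: "nat list \<Rightarrow> nat" where
  "word_size w = sum_list (map bit_length w)"

definition computable :: "(nat \<Rightarrow> nat) \<Rightarrow> bool" where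
  "computable f \<longleftrightarrow> (\<exists>p. \<forall>n. \<exists>t s. exec p (init_store [n]) t s \<and> result s = f n)"


section \<open>Fixed-parameter tractability\<close>

text \<open>
  \<open>encodes x w\<close> means that the word \<open>w\<close> is a description of the instance \<open>x\<close>. An instance may have
  many descriptions, and the program has to be correct on all of them. The
  parameter is real-valued and may be negative; it is rounded up to the next
  natural number, so that all instances with parameter at most 0 have to be decided
  in polynomial time. The value of the parameter is not part of the input.
\<close>

definition fixed_parameter_tractable ::
  "'i set \<Rightarrow> ('i \<Rightarrow> nat list \<Rightarrow> bool) \<Rightarrow> ('i \<Rightarrow> bool) \<Rightarrow> ('i \<Rightarrow> real) \<Rightarrow> bool" where
  "fixed_parameter_tractable insts encodes yes par \<longleftrightarrow>
     (\<exists>p f c. computable f \<and>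
       (\<forall>x\<in>insts. \<forall>w. encodes x w \<longrightarrow>
         (\<exists>t s. exec p (init_store w) t s \<and>
                t \<le> f (nat \<lceil>par x\<rceil>) * word_size w ^ c \<and>
                (result s \<noteq> 0 \<longleftrightarrow> yes x))))"


section \<open>Colored Clustering\<close>

definition simple_graph :: "'v set \<Rightarrow> 'v set set \<Rightarrow> bool" where
  "simple_graph V E \<longleftrightarrow> finite V \<and> E \<subseteq> {{u, v} | u v. u \<in> V \<and> v \<in> V \<and> u \<noteq> v}"

definition deg :: "'v set set \<Rightarrow> 'v \<Rightarrow> nat" where
  "deg E v = card {e \<in> E. v \<in> e}"

definition col_deg :: "'v set set \<Rightarrow> ('v set \<Rightarrow> 'c) \<Rightarrow> 'c \<Rightarrow> 'v \<Rightarrow> nat" where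
  "col_deg E l c v = card {e \<in> E. v \<in> e \<and> l e = c}"

definition stable :: "('v set \<Rightarrow> 'c) \<Rightarrow> 'v set set \<Rightarrow> bool" where
  "stable l F \<longleftrightarrow> (\<forall>e\<in>F. \<forall>e'\<in>F. e \<inter> e' \<noteq> {} \<longrightarrow> l e = l e')"

text \<open>
  \<open>C\<close> may be infinite: \<open>Max\<close> ranges over a set of numbers bounded by \<open>deg E v\<close>.
\<close>

definition rho' :: "'v set \<Rightarrow> 'v set set \<Rightarrow> 'c set \<Rightarrow> ('v set \<Rightarrow> 'c) \<Rightarrow> real" where
  "rho' V E C l = 1/2 * (\<Sum>v\<in>V.
     min (real (deg E v) - real (Max ((\<lambda>c. col_deg E l c v) ` C))) (1/2 * real (deg E v)))"

text \<open>
  Instances are tuples \<open>(V, E, C, l, k)\<close>. Since they are given to a machine, vertices and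
  colors are named by natural numbers.
\<close>

type_synonym instance_cc = "nat set \<times> nat set set \<times> nat set \<times> (nat set \<Rightarrow> nat) \<times> nat"

definition cc_instances :: "instance_cc set" where
  "cc_instances = {(V, E, C, l, k). simple_graph V E \<and> C \<noteq> {} \<and> (\<forall>e\<in>E. l e \<in> C)}"

text \<open>
  A graph is described by a list of its vertices and a list of its edges in any
  order, each edge being given by its two ends and its color. Colors that are not used do
  not occur in the description.
\<close>

definition cc_encodes :: "instance_cc \<Rightarrow> nat list \<Rightarrow> bool" where
  "cc_encodes = (\<lambda>(V, E, C, l, k) w. \<exists>vs es.
     distinct vs \<and> set vs = V \<and>
     distinct (map (\<lambda>(u, v). {u, v}) es) \<and> set (map (\<lambda>(u, v). {u, v}) es) = E \<and>
     w = [length vs, length es, k] @ vs @ concat (map (\<lambda>(u, v). [u, v, l {u, v}]) es))"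

definition colored_clustering :: "instance_cc \<Rightarrow> bool" where
  "colored_clustering = (\<lambda>(V, E, C, l, k). \<exists>F\<subseteq>E. stable l F \<and> card F \<ge> k)"

lemma cc_encoding_exists:
  assumes "x \<in> cc_instances"
  shows "\<exists>w. cc_encodes x w"
proof -
  obtain V E C l k where x: "x = (V, E, C, l, k)" by (cases x)
  with assms have V: "finite V" and E: "E \<subseteq> {{u, v} | u v. u \<in> V \<and> v \<in> V \<and> u \<noteq> v}"
    by (auto simp: cc_instances_def simple_graph_def)
  have "E \<subseteq> Pow V" using E by auto
  then have "finite E" using V by (simp add: finite_subset)
  then obtain ds where ds: "distinct ds" "set ds = E" using finite_distinct_list by blast
  obtain vs where vs: "distinct vs" "set vs = V" using V finite_distinct_list by blast
  have "\<forall>e\<in>E. \<exists>p. e = (\<lambda>(u, v). {u, v}) p" using E by fastforce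
  then obtain g where g: "\<And>e. e \<in> E \<Longrightarrow> (\<lambda>(u, v). {u, v}) (g e) = e" by metis
  have "map (\<lambda>(u, v). {u, v}) (map g ds) = ds"
    unfolding map_map by (rule map_idI) (use g ds(2) in auto)
  then have "distinct (map (\<lambda>(u, v). {u, v}) (map g ds)) \<and>
      set (map (\<lambda>(u, v). {u, v}) (map g ds)) = E"
    using ds by metis
  then show ?thesis
    unfolding x cc_encodes_def prod.case using vs by blast
qed

end

theory Submission
  imports Defs
begin

text \<open>
  Let two edges be in conflict if they share a vertex and have different colors. A set of edges is
  stable iff its complement is a vertex cover of the conflict graph, so the task is to find a vertex
  cover of size at most \<open>r\<close>. At a vertex \<open>v\<close> the conflict graph is complete multipartite, hence a
  fractional vertex cover has total value at least \<open>min (deg v - max\<^sub>c deg\<^sub>c v) (deg v / 2)\<close> on the edges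
  at \<open>v\<close>; summing over \<open>v\<close> counts every edge twice and shows that \<open>\<rho>'\<close> is at most the optimum of
  the linear program. Therefore it suffices to solve Vertex Cover above the linear programming bound.

  Doubled values make this bound an integer. Process the vertices one by one: if putting a vertex
  (or else its neighborhood) into the cover leaves the bound unchanged, then by persistence some
  optimal cover extends this choice; otherwise both choices raise the bound by at least 1. A path
  of this branching whose bound does not exceed \<open>2 r\<close> is described by at most \<open>2 (r - \<rho>')\<close> bits, and the machine
  tries all of them, which takes \<open>4 ^ (r - \<rho>')\<close> rounds. The doubled bound is the size of a
  maximum matching in the bipartite double cover; an auction computes it by local operations only.
\<close>

section \<open>Vertex cover above the linear programming bound\<close>

locale conflict_graph =
  fixes m :: nat and adj :: "nat \<Rightarrow> nat \<Rightarrow> bool"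
  assumes adj_sym: "adj i j \<Longrightarrow> adj j i"
begin

section \<open>Half-integral covers and persistence\<close>

text \<open>
  Fractional vertex covers with value at least 1 on \<open>D\<close>, scaled by 2 so that half-integral values
  become natural numbers; \<open>opt D\<close> is twice the optimum of the linear program.
\<close>

definition hcover :: "nat set \<Rightarrow> (nat \<Rightarrow> nat) \<Rightarrow> bool" where
  "hcover D x \<longleftrightarrow> (\<forall>i\<in>D. 2 \<le> x i) \<and> (\<forall>i<m. \<forall>j<m. adj i j \<longrightarrow> 2 \<le> x i + x j)"

definition opt :: "nat set \<Rightarrow> nat" where
  "opt D = (LEAST n. \<exists>x. hcover D x \<and> n = sum x {..<m})"

definition vcover :: "nat set \<Rightarrow> bool" where
  "vcover S \<longleftrightarrow> S \<subseteq> {..<m} \<and> (\<forall>i<m. \<forall>j<m. adj i j \<longrightarrow> i \<in> S \<or> j \<in> S)"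

definition nbrs :: "nat \<Rightarrow> nat set" where
  "nbrs v = {j. j < m \<and> adj v j}"

lemma opt_le: "hcover D x \<Longrightarrow> opt D \<le> sum x {..<m}"
  unfolding opt_def by (rule Least_le) blast

lemma opt_attained:
  obtains x where "hcover D x" "sum x {..<m} = opt D"
proof -
  have "hcover D (\<lambda>_. 2)" by (simp add: hcover_def)
  then have "\<exists>n x. hcover D x \<and> n = sum x {..<m}" by blast
  from LeastI_ex[OF this] have "\<exists>x. hcover D x \<and> opt D = sum x {..<m}"
    unfolding opt_def .
  then show thesis using that by force
qed

lemma opt_mono: "D \<subseteq> D' \<Longrightarrow> opt D \<le> opt D'"
proof -
  assume sub: "D \<subseteq> D'"
  obtain x where x: "hcover D' x" "sum x {..<m} = opt D'" by (rule opt_attained)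
  from x(1) sub have "hcover D x" unfolding hcover_def by blast
  from opt_le[OF this] show "opt D \<le> opt D'" using x(2) by simp
qed

lemma opt_le_vcover:
  assumes "vcover S" "D \<subseteq> S"
  shows "opt D \<le> 2 * card S"
proof -
  have "hcover D (\<lambda>i. if i \<in> S then 2 else 0)"
    using assms unfolding hcover_def vcover_def by auto
  from opt_le[OF this] show ?thesis
    using assms(1) by (simp add: vcover_def sum.If_cases Int_absorb1)
qed

text \<open>Turns a small bound at the end of a branching path into a small cover, since the set
  \<open>D\<close> reached there is itself a vertex cover.\<close>

lemma card_le_opt:
  assumes "D \<subseteq> {..<m}"
  shows "2 * card D \<le> opt D"
proof -
  obtain x where x: "hcover D x" "sum x {..<m} = opt D" by (rule opt_attained)
  have "2 * card D = (\<Sum>i\<in>D. 2)" by simp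
  also have "\<dots> \<le> sum x D" using x(1) by (intro sum_mono) (auto simp: hcover_def)
  also have "\<dots> \<le> sum x {..<m}" using assms by (intro sum_mono2) auto
  finally show ?thesis using x(2) by simp
qed

text \<open>
  The Nemhauser-Trotter argument: round \<open>S\<close> by adding the vertices of value at least 2 and removing
  those of value 0. If this enlarged \<open>S\<close>, moving \<open>x\<close> towards 1 on the changed vertices would give
  a better fractional cover of \<open>D\<close>.
\<close>

lemma persistence:
  assumes D: "D \<subseteq> D'" and eq: "opt D' = opt D" and S: "vcover S" "D \<subseteq> S" and D': "D' \<subseteq> {..<m}"
  obtains S' where "vcover S'" "D' \<subseteq> S'" "card S' \<le> card S"
proof -
  obtain x where x: "hcover D' x" "sum x {..<m} = opt D'" by (rule opt_attained)
  define P where "P = {i. i < m \<and> 2 \<le> x i \<and> i \<notin> S}"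
  define Q where "Q = {i. i < m \<and> x i = 0 \<and> i \<in> S}"
  define y where "y = (\<lambda>i. if i \<in> P then x i - 1 else if i \<in> Q then 1 else x i)"
  define S' where "S' = (S \<union> P) - Q"
  have SM: "S \<subseteq> {..<m}" using S by (simp add: vcover_def)
  then have finS: "finite S" by (rule finite_subset) simp
  have fin: "finite P" "finite Q" by (auto simp: P_def Q_def)
  have xe: "2 \<le> x i + x j" if "i < m" "j < m" "adj i j" for i j
    using x(1) that by (simp add: hcover_def)
  have xD: "2 \<le> x i" if "i \<in> D'" for i using x(1) that by (simp add: hcover_def)
  have Sc: "i \<in> S \<or> j \<in> S" if "i < m" "j < m" "adj i j" for i j
    using S that by (simp add: vcover_def)
  \<comment> \<open>A lowered vertex lies outside \<open>S\<close>, so each of its neighbors lies in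
    \<open>S\<close> and, if it had value 0, is raised to 1. Vertices of \<open>D\<close> lie in
    \<open>S\<close> and have value at least 2, so they are not changed.\<close>
  have "hcover D y"
    unfolding hcover_def
  proof (intro conjI ballI allI impI)
    fix i assume "i \<in> D"
    then show "2 \<le> y i" using xD[of i] D S(2) by (auto simp: y_def P_def Q_def)
  next
    fix i j assume ij: "i < m" "j < m" "adj i j"
    show "2 \<le> y i + y j"
      using xe[OF ij] Sc[OF ij] ij by (auto simp: y_def P_def Q_def)
  qed
  \<comment> \<open>Here \<open>opt D' = opt D\<close> enters: \<open>x\<close> is optimal for
    \<open>D\<close> too, so \<open>y\<close> cannot be cheaper. Hence at least as many vertices are
    raised as lowered.\<close>
  then have "sum x {..<m} \<le> sum y {..<m}" using opt_le x(2) eq by simp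
  moreover have "(\<Sum>i<m. y i + (if i \<in> P then 1 else 0)) = (\<Sum>i<m. x i + (if i \<in> Q then 1 else 0))"
    by (rule sum.cong) (auto simp: y_def P_def Q_def)
  moreover have "(\<Sum>i<m. if i \<in> P then 1 else 0) = card P" "(\<Sum>i<m. if i \<in> Q then 1 else 0) = card Q"
    by (auto simp: sum.If_cases P_def Q_def intro!: arg_cong[where f=card])
  ultimately have PQ: "card P \<le> card Q" by (simp add: sum.distrib)
  have "card S' = card (S \<union> P) - card Q"
    unfolding S'_def using fin by (intro card_Diff_subset) (auto simp: Q_def)
  also have "card (S \<union> P) = card S + card P"
    using finS fin by (intro card_Un_disjoint) (auto simp: P_def)
  finally have "card S' \<le> card S" using PQ by simp
  moreover have "D' \<subseteq> S'"
  proof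
    fix i assume "i \<in> D'"
    then show "i \<in> S'" using xD[of i] D' by (auto simp: S'_def P_def Q_def)
  qed
  \<comment> \<open>If an end in \<open>S\<close> was removed, its value is 0, so the other end has
    value at least 2 and lies in \<open>S\<close> or was added.\<close>
  moreover have "vcover S'"
    unfolding vcover_def
  proof (intro conjI allI impI)
    show "S' \<subseteq> {..<m}" using SM by (auto simp: S'_def P_def)
    fix i j assume ij: "i < m" "j < m" "adj i j"
    show "i \<in> S' \<or> j \<in> S'"
      using xe[OF ij] Sc[OF ij] ij by (auto simp: S'_def P_def Q_def)
  qed
  ultimately show thesis using that by blast
qed

section \<open>Branching along the bits of a guess\<close>

text \<open>
  One step of the branching along a path described by the bits of \<open>h\<close>, lowest bit first. A bit is
  consumed only if both alternatives increase \<open>opt\<close>.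
\<close>

definition decide :: "nat \<Rightarrow> nat set \<times> nat \<Rightarrow> nat set \<times> nat" where
  "decide v = (\<lambda>(D, h).
     if opt (insert v D) = opt D then (insert v D, h)
     else if opt (D \<union> nbrs v) = opt D then (D \<union> nbrs v, h)
     else (if odd h then D \<union> nbrs v else insert v D, h div 2))"

abbreviation decide_all :: "nat \<Rightarrow> nat \<Rightarrow> nat set \<times> nat" where
  "decide_all k h \<equiv> fold decide [0..<k] ({}, h)"

text \<open>The budget left, \<open>b - opt D\<close>, is the potential: each consumed bit lowers it
  by at least 1, so that many bits suffice. The cover \<open>S\<close> is arbitrary in the induction
  because a greedy step may replace it by the cover that \<open>persistence\<close>
  provides.\<close>

lemma fold_decide_complete:
  assumes "vcover S" "D \<subseteq> S" "2 * card S \<le> b" "set vs \<subseteq> {..<m}"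
  shows "\<exists>h < 2 ^ (b - opt D). opt (fst (fold decide vs (D, h))) \<le> b"
  using assms
proof (induction vs arbitrary: D S)
  case Nil
  then show ?case using opt_le_vcover[of S D] by (intro exI[of _ 0]) auto
next
  case (Cons v vs)
  have DM: "D \<subseteq> {..<m}" using Cons.prems by (auto simp: vcover_def)
  have v: "v < m" "set vs \<subseteq> {..<m}" using Cons.prems by auto
  have greedy: ?case if eq: "opt D' = opt D" and sub: "D \<subseteq> D'" "D' \<subseteq> {..<m}"
      and dec: "\<And>h. decide v (D, h) = (D', h)" for D'
  proof -
    obtain S' where S': "vcover S'" "D' \<subseteq> S'" "card S' \<le> card S"
      using persistence[OF sub(1) eq Cons.prems(1,2) sub(2)] by blast
    then obtain h where "h < 2 ^ (b - opt D')" "opt (fst (fold decide vs (D', h))) \<le> b"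
      using Cons.IH[OF S'(1,2) _ v(2)] Cons.prems(3) by auto
    then show ?thesis using eq dec by auto
  qed
  \<comment> \<open>The bit \<open>c\<close>, 0 for the vertex and 1 for its neighborhood, becomes
    the new lowest bit of the guess; the growth of \<open>opt\<close> pays for the doubled
    range.\<close>
  have branch: ?case if ne: "opt D' \<noteq> opt D" and sub: "D \<subseteq> D'" "D' \<subseteq> S"
      and dec: "\<And>h. decide v (D, 2 * h + c) = (D', h)" and c: "c \<le> 1" for D' c
  proof -
    obtain h where h: "h < 2 ^ (b - opt D')" "opt (fst (fold decide vs (D', h))) \<le> b"
      using Cons.IH[OF Cons.prems(1) sub(2) Cons.prems(3) v(2)] by auto
    have "opt D < opt D'" "opt D' \<le> b"
      using opt_mono[OF sub(1)] ne opt_le_vcover[OF Cons.prems(1) sub(2)] Cons.prems(3) by auto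
    then have "Suc (b - opt D') \<le> b - opt D" by simp
    then have "(2::nat) ^ Suc (b - opt D') \<le> 2 ^ (b - opt D)" by (intro power_increasing) auto
    then have "2 * h + c < 2 ^ (b - opt D)" using h(1) c by simp
    then show ?thesis using h(2) dec by (intro exI[of _ "2 * h + c"]) simp
  qed
  show ?case
  proof (cases "opt (insert v D) = opt D")
    case True
    then show ?thesis using DM v by (intro greedy[of "insert v D"]) (auto simp: decide_def)
  next
    case ne1: False
    show ?thesis
    proof (cases "opt (D \<union> nbrs v) = opt D")
      case True
      then show ?thesis using DM ne1
        by (intro greedy[of "D \<union> nbrs v"]) (auto simp: decide_def nbrs_def)
    next
      case ne2: False
      show ?thesis
      proof (cases "v \<in> S")
        case True
        then show ?thesis using ne1 ne2 Cons.prems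
          by (intro branch[of "insert v D" 0]) (auto simp: decide_def)
      next
        case False
        then have "nbrs v \<subseteq> S" using v Cons.prems(1) by (auto simp: vcover_def nbrs_def)
        then show ?thesis using ne1 ne2 Cons.prems
          by (intro branch[of "D \<union> nbrs v" 1]) (auto simp: decide_def)
      qed
    qed
  qed
qed

text \<open>Whatever the guess, each processed vertex enters the set itself or with its whole
  neighborhood. Thus every completed path yields a cover, and a wrong guess cannot cause a wrong
  positive answer.\<close>

lemma decide_all_sound:
  assumes "k \<le> m"
  shows "fst (decide_all k h) \<subseteq> {..<m} \<and>
    (\<forall>v<k. v \<in> fst (decide_all k h) \<or> nbrs v \<subseteq> fst (decide_all k h))"
  using assms
proof (induction k)
  case (Suc k)
  obtain D h' where D: "decide_all k h = (D, h')" by fastforce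
  define D' where "D' = fst (decide_all (Suc k) h)"
  have D': "D' = fst (decide k (D, h'))" by (simp add: D'_def D)
  have "D' = insert k D \<or> D' = D \<union> nbrs k" unfolding D' by (auto simp: decide_def)
  then show ?case using Suc D unfolding D'_def[symmetric] by (auto simp: less_Suc_eq nbrs_def)
qed simp

theorem decide_all_correct:
  "(\<exists>h < 2 ^ (b - opt {}). opt (fst (decide_all m h)) \<le> b) \<longleftrightarrow> (\<exists>S. vcover S \<and> 2 * card S \<le> b)"
proof
  assume "\<exists>h < 2 ^ (b - opt {}). opt (fst (decide_all m h)) \<le> b"
  then obtain h where h: "opt (fst (decide_all m h)) \<le> b" by blast
  let ?D = "fst (decide_all m h)"
  have "vcover ?D"
    using decide_all_sound[of m h] by (auto simp: vcover_def nbrs_def)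
  then show "\<exists>S. vcover S \<and> 2 * card S \<le> b"
    using h card_le_opt[of ?D] by (auto simp: vcover_def intro!: exI[of _ ?D])
next
  assume "\<exists>S. vcover S \<and> 2 * card S \<le> b"
  then show "\<exists>h < 2 ^ (b - opt {}). opt (fst (decide_all m h)) \<le> b"
    using fold_decide_complete[of _ "{}" b "[0..<m]"] by (auto simp: atLeast0LessThan)
qed

section \<open>Computing the bound by an auction\<close>

text \<open>
  Maximum matching in the bipartite double cover of the graph induced on the complement of \<open>D\<close>, by
  an auction. The vertices on the left bid for a cheapest neighbor on the right, whose price \<open>p\<close>
  rises by 1, and give up once all neighbors cost more than \<open>m\<close>. The right vertex \<open>w\<close> is owned by
  \<open>i\<close> if \<open>ow w = Suc i\<close>, and free if \<open>ow w = 0\<close>. The next bidder is \<open>u\<close>; the vertices from \<open>c\<close> on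
  have not bid yet.
\<close>

definition alive :: "nat set \<Rightarrow> nat \<Rightarrow> nat \<Rightarrow> bool" where
  "alive D i j \<longleftrightarrow> adj i j \<and> i \<notin> D \<and> j \<notin> D"

definition bidding_inv :: "nat set \<Rightarrow> nat \<Rightarrow> nat \<Rightarrow> (nat \<Rightarrow> nat) \<Rightarrow> (nat \<Rightarrow> nat) \<Rightarrow> bool" where
  "bidding_inv D u c p ow \<longleftrightarrow> u < c \<and> c \<le> Suc m \<and>
     (\<forall>w<m. p w \<le> Suc m) \<and>
     (\<forall>w<m. ow w = 0 \<longrightarrow> p w = 0) \<and>
     (\<forall>w<m. \<forall>i. ow w = Suc i \<longrightarrow> i < m \<and> i < c \<and> i \<noteq> u \<and> alive D i w \<and>
        (\<forall>j<m. alive D i j \<longrightarrow> p w \<le> Suc (p j))) \<and>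
     (\<forall>w<m. \<forall>w'<m. ow w = ow w' \<longrightarrow> ow w \<noteq> 0 \<longrightarrow> w = w') \<and>
     (\<forall>i<m. i < c \<longrightarrow> i \<noteq> u \<longrightarrow>
        (\<exists>w<m. ow w = Suc i) \<or> (\<forall>j<m. alive D i j \<longrightarrow> m < p j))"

lemma bidding_invD:
  assumes "bidding_inv D u c p ow"
  shows "u < c" "c \<le> Suc m"
    and "\<And>w. w < m \<Longrightarrow> p w \<le> Suc m"
    and "\<And>w. w < m \<Longrightarrow> ow w = 0 \<Longrightarrow> p w = 0"
    and "\<And>w i. w < m \<Longrightarrow> ow w = Suc i \<Longrightarrow> i < m \<and> i < c \<and> i \<noteq> u \<and> alive D i w"
    and "\<And>w i j. w < m \<Longrightarrow> ow w = Suc i \<Longrightarrow> j < m \<Longrightarrow> alive D i j \<Longrightarrow> p w \<le> Suc (p j)"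
    and "\<And>w w'. w < m \<Longrightarrow> w' < m \<Longrightarrow> ow w = ow w' \<Longrightarrow> ow w \<noteq> 0 \<Longrightarrow> w = w'"
    and "\<And>i. i < m \<Longrightarrow> i < c \<Longrightarrow> i \<noteq> u \<Longrightarrow>
        (\<exists>w<m. ow w = Suc i) \<or> (\<forall>j<m. alive D i j \<longrightarrow> m < p j)"
proof -
  have a: "u < c" "c \<le> Suc m" "\<forall>w<m. p w \<le> Suc m" "\<forall>w<m. ow w = 0 \<longrightarrow> p w = 0"
    and o: "\<forall>w<m. \<forall>i. ow w = Suc i \<longrightarrow> i < m \<and> i < c \<and> i \<noteq> u \<and> alive D i w \<and>
        (\<forall>j<m. alive D i j \<longrightarrow> p w \<le> Suc (p j))"
    and j: "\<forall>w<m. \<forall>w'<m. ow w = ow w' \<longrightarrow> ow w \<noteq> 0 \<longrightarrow> w = w'"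
    and e: "\<forall>i<m. i < c \<longrightarrow> i \<noteq> u \<longrightarrow>
        (\<exists>w<m. ow w = Suc i) \<or> (\<forall>j<m. alive D i j \<longrightarrow> m < p j)"
    using assms unfolding bidding_inv_def by - (elim conjE, assumption)+
  show "u < c" "c \<le> Suc m" using a by auto
  show "p w \<le> Suc m" if "w < m" for w using a that by blast
  show "p w = 0" if "w < m" "ow w = 0" for w using a that by blast
  show "i < m \<and> i < c \<and> i \<noteq> u \<and> alive D i w" if "w < m" "ow w = Suc i" for w i
    using o that by blast
  show "p w \<le> Suc (p j)" if "w < m" "ow w = Suc i" "j < m" "alive D i j" for w i j
    using o that by blast
  show "w = w'" if "w < m" "w' < m" "ow w = ow w'" "ow w \<noteq> 0" for w w'
    using j that by blast
  show "(\<exists>w<m. ow w = Suc i) \<or> (\<forall>j<m. alive D i j \<longrightarrow> m < p j)"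
    if "i < m" "i < c" "i \<noteq> u" for i
    using e that by blast
qed

lemma bidding_init: "\<forall>w<m. p w = 0 \<and> ow w = 0 \<Longrightarrow> bidding_inv D 0 1 p ow"
  by (auto simp: bidding_inv_def)

text \<open>The bidder gives up and becomes settled by the second alternative of the last clause;
  prices and owners stay.\<close>

lemma bidding_drop:
  assumes "bidding_inv D u c p ow" "u < m" "c \<le> m" "\<forall>j<m. alive D u j \<longrightarrow> m < p j"
  shows "bidding_inv D c (Suc c) p ow"
proof -
  note a = bidding_invD[OF assms(1)]
  show ?thesis
    unfolding bidding_inv_def
  proof (intro conjI allI impI)
    show "c < Suc c" "Suc c \<le> Suc m" using assms(3) by auto
  next
    fix w i assume w: "w < m" "ow w = Suc i"
    show "i < m" "i < Suc c" "i \<noteq> c" "alive D i w" using a(5)[OF w] by auto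
    show "p w \<le> Suc (p j)" if "j < m" "alive D i j" for j using a(6)[OF w that] .
  next
    fix i assume "i < m" "i < Suc c" "i \<noteq> c"
    then show "(\<exists>w<m. ow w = Suc i) \<or> (\<forall>j<m. alive D i j \<longrightarrow> m < p j)"
      using a(8)[of i] assms(4) by (cases "i = u") auto
  qed (use a(3,4,7) in blast)+
qed

text \<open>As \<open>b\<close> was a cheapest neighbor of \<open>u\<close>, its new price exceeds
  that of any neighbor of \<open>u\<close> by at most 1. For every other owner a price increase
  elsewhere only relaxes its inequality.\<close>

lemma bidding_bid_free:
  assumes "bidding_inv D u c p ow" "u < m" "c \<le> m" "b < m" "alive D u b" "p b \<le> m"
    "\<forall>j<m. alive D u j \<longrightarrow> p b \<le> p j" "ow b = 0"
  shows "bidding_inv D c (Suc c) (p(b := Suc (p b))) (ow(b := Suc u))"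
proof -
  note owned = bidding_invD(5)[OF assms(1)] and slack = bidding_invD(6)[OF assms(1)] and inj = bidding_invD(7)[OF assms(1)]
    and settled = bidding_invD(8)[OF assms(1)]
  note u = bidding_invD(1-4)[OF assms(1)]
  show ?thesis
    unfolding bidding_inv_def
  proof (intro conjI allI impI)
    fix w i assume w: "w < m" "(ow(b := Suc u)) w = Suc i"
    have "i < m \<and> i < Suc c \<and> i \<noteq> c \<and> alive D i w"
    proof (cases "w = b")
      case True then show ?thesis using w assms u by simp
    next
      case False then show ?thesis using w owned[of w i] by simp
    qed
    then show "i < m" "i < Suc c" "i \<noteq> c" "alive D i w" by auto
    fix j assume j: "j < m" "alive D i j"
    have "(p(b := Suc (p b))) w \<le> Suc (p j)"
    proof (cases "w = b")
      case True then show ?thesis using w j assms(7) by simp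
    next
      case False then show ?thesis using w j slack[of w i j] by simp
    qed
    also have "\<dots> \<le> Suc ((p(b := Suc (p b))) j)" by simp
    finally show "(p(b := Suc (p b))) w \<le> Suc ((p(b := Suc (p b))) j)" .
  next
    \<comment> \<open>The bidder \<open>u\<close> owned nothing before, so no second vertex carries
      its mark.\<close>
    fix w w' assume "w < m" "w' < m" "(ow(b := Suc u)) w = (ow(b := Suc u)) w'"
      "(ow(b := Suc u)) w \<noteq> 0"
    then show "w = w'" using owned[of w u] owned[of w' u] inj[of w w']
      by (cases "w = b"; cases "w' = b") auto
  next
    fix i assume i: "i < m" "i < Suc c" "i \<noteq> c"
    show "(\<exists>w<m. (ow(b := Suc u)) w = Suc i) \<or> (\<forall>j<m. alive D i j \<longrightarrow> m < (p(b := Suc (p b))) j)"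
    proof (cases "i = u")
      case True
      then show ?thesis using assms(4) by (intro disjI1 exI[of _ b]) simp
    next
      case False
      then have "(\<exists>w<m. ow w = Suc i) \<or> (\<forall>j<m. alive D i j \<longrightarrow> m < p j)"
        using settled[of i] i by auto
      then show ?thesis
      proof
        assume "\<exists>w<m. ow w = Suc i"
        then obtain w where "w < m" "ow w = Suc i" by blast
        then show ?thesis using assms(8) by (intro disjI1 exI[of _ w]) auto
      next
        assume "\<forall>j<m. alive D i j \<longrightarrow> m < p j"
        then show ?thesis by (auto intro: less_SucI)
      qed
    qed
  qed (use u assms(2-6) in \<open>auto split: if_splits\<close>)
qed

text \<open>The evicted owner \<open>i'\<close> changes roles with \<open>u\<close>: it becomes the
  bidder and \<open>u\<close> becomes settled, while \<open>c\<close> stays.\<close>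

lemma bidding_bid_displace:
  assumes "bidding_inv D u c p ow" "u < m" "b < m" "alive D u b" "p b \<le> m"
    "\<forall>j<m. alive D u j \<longrightarrow> p b \<le> p j" "ow b = Suc i'"
  shows "bidding_inv D i' c (p(b := Suc (p b))) (ow(b := Suc u))" "i' < m"
proof -
  note owned = bidding_invD(5)[OF assms(1)] and slack = bidding_invD(6)[OF assms(1)] and inj = bidding_invD(7)[OF assms(1)]
    and settled = bidding_invD(8)[OF assms(1)]
  note u = bidding_invD(1-4)[OF assms(1)]
  have i': "i' < m" "i' < c" "i' \<noteq> u" using owned[of b i'] assms(3,7) by auto
  then show "i' < m" by simp
  show "bidding_inv D i' c (p(b := Suc (p b))) (ow(b := Suc u))"
    unfolding bidding_inv_def
  proof (intro conjI allI impI)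
    fix w i assume w: "w < m" "(ow(b := Suc u)) w = Suc i"
    have "i < m \<and> i < c \<and> i \<noteq> i' \<and> alive D i w"
    proof (cases "w = b")
      case True then show ?thesis using w assms i' u by simp
    next
      case False then show ?thesis using w owned[of w i] inj[of w b] assms(3,7) by auto
    qed
    then show "i < m" "i < c" "i \<noteq> i'" "alive D i w" by auto
    fix j assume j: "j < m" "alive D i j"
    have "(p(b := Suc (p b))) w \<le> Suc (p j)"
    proof (cases "w = b")
      case True then show ?thesis using w j assms(6) by simp
    next
      case False then show ?thesis using w j slack[of w i j] by simp
    qed
    also have "\<dots> \<le> Suc ((p(b := Suc (p b))) j)" by simp
    finally show "(p(b := Suc (p b))) w \<le> Suc ((p(b := Suc (p b))) j)" .
  next
    fix w w' assume "w < m" "w' < m" "(ow(b := Suc u)) w = (ow(b := Suc u)) w'"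
      "(ow(b := Suc u)) w \<noteq> 0"
    then show "w = w'" using owned[of w u] owned[of w' u] inj[of w w']
      by (cases "w = b"; cases "w' = b") auto
  next
    fix i assume i: "i < m" "i < c" "i \<noteq> i'"
    show "(\<exists>w<m. (ow(b := Suc u)) w = Suc i) \<or> (\<forall>j<m. alive D i j \<longrightarrow> m < (p(b := Suc (p b))) j)"
    proof (cases "i = u")
      case True
      then show ?thesis using assms(3) by (intro disjI1 exI[of _ b]) simp
    next
      case False
      then have "(\<exists>w<m. ow w = Suc i) \<or> (\<forall>j<m. alive D i j \<longrightarrow> m < p j)"
        using settled[of i] i by auto
      then show ?thesis
      proof
        assume "\<exists>w<m. ow w = Suc i"
        then obtain w where "w < m" "ow w = Suc i" by blast
        then show ?thesis using assms(7) i by (intro disjI1 exI[of _ w]) auto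
      next
        assume "\<forall>j<m. alive D i j \<longrightarrow> m < p j"
        then show ?thesis by (auto intro: less_SucI)
      qed
    qed
  qed (use u assms(2-5) i' in \<open>auto split: if_splits\<close>)
qed

text \<open>
  Some price \<open>g\<close> between 1 and \<open>m + 1\<close> does not occur. As an owner never pays more than 1 above its
  cheapest neighbor, the vertices of price above \<open>g\<close> on the right and the owners paying less than
  \<open>g\<close> on the left form a cover with one vertex on every matching edge (Koenig duality).
\<close>

lemma bidding_opt:
  assumes inv: "bidding_inv D u c p ow" and u: "m \<le> u" and D: "D \<subseteq> {..<m}"
  shows "opt D = 2 * card D + card {w. w < m \<and> ow w \<noteq> 0}"
proof (rule antisym)
  note c = bidding_invD(1)[OF inv] and zero = bidding_invD(4)[OF inv] and slack = bidding_invD(6)[OF inv]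
    and settled = bidding_invD(8)[OF inv]
  let ?M = "{w. w < m \<and> ow w \<noteq> 0}"
  have finD: "finite D" using D by (rule finite_subset) simp
  \<comment> \<open>Pigeonhole: \<open>m + 1\<close> candidate prices, but only \<open>m\<close>
    vertices on the right.\<close>
  have "\<not> {1..Suc m} \<subseteq> p ` {..<m}"
  proof
    assume "{1..Suc m} \<subseteq> p ` {..<m}"
    then have "card {1..Suc m} \<le> card (p ` {..<m})" by (intro card_mono) auto
    also have "\<dots> \<le> m" using card_image_le[of "{..<m}" p] by simp
    finally show False by simp
  qed
  then obtain g where "g \<in> {1..Suc m}" "g \<notin> p ` {..<m}" by blast
  then have g: "1 \<le> g" "g \<le> Suc m" "\<And>w. w < m \<Longrightarrow> p w \<noteq> g" by auto
  define L where "L = (\<lambda>w. ow w - 1) ` {w. w < m \<and> ow w \<noteq> 0 \<and> p w < g}"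
  define R where "R = {w. w < m \<and> g \<le> p w}"
  \<comment> \<open>Each vertex has a left and a right copy in the double cover; a copy in the cover
    contributes one half, which is 1 in doubled values.\<close>
  define x where "x = (\<lambda>i. of_bool (i \<in> L) + of_bool (i \<in> R) + 2 * of_bool (i \<in> D) :: nat)"
  have cov: "i \<in> L \<or> j \<in> R" if ij: "i < m" "j < m" "alive D i j" for i j
  proof (cases "g \<le> p j")
    case False
    \<comment> \<open>So \<open>i\<close> has not given up and owns some \<open>w\<close>. Then
      \<open>p w \<le> p j + 1 \<le> g\<close>, and \<open>p w = g\<close> is excluded by the choice
      of \<open>g\<close>.\<close>
    then have "\<not> m < p j" using g(2) by simp
    then obtain w where w: "w < m" "ow w = Suc i" using settled[of i] c u ij by fastforce
    then have "p w \<le> Suc (p j)" using slack ij by blast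
    then have "p w < g" using False g(3)[OF w(1)] by simp
    then have "i \<in> L" unfolding L_def using w by (intro image_eqI[of _ _ w]) auto
    then show ?thesis by simp
  qed (use that in \<open>auto simp: R_def\<close>)
  have "hcover D x"
    unfolding hcover_def
  proof (intro conjI ballI allI impI)
    fix i assume "i \<in> D" then show "2 \<le> x i" by (simp add: x_def)
  next
    fix i j assume ij: "i < m" "j < m" "adj i j"
    show "2 \<le> x i + x j"
    proof (cases "i \<in> D \<or> j \<in> D")
      case True then show ?thesis by (auto simp: x_def)
    next
      case False
      then have "alive D i j" "alive D j i" using ij adj_sym by (auto simp: alive_def)
      \<comment> \<open>An edge occurs in the double cover in both orientations, and both are
        covered.\<close>
      then have "i \<in> L \<or> j \<in> R" "j \<in> L \<or> i \<in> R" using cov ij by blast+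
      then show ?thesis by (auto simp: x_def)
    qed
  qed
  then have "opt D \<le> sum x {..<m}" by (rule opt_le)
  also have "\<dots> = card ({..<m} \<inter> L) + card ({..<m} \<inter> R) + 2 * card ({..<m} \<inter> D)"
    unfolding x_def by (simp add: sum.distrib sum_distrib_left[symmetric] Int_def)
  also have "\<dots> \<le> card {w. w < m \<and> ow w \<noteq> 0 \<and> p w < g} + card R + 2 * card D"
  proof -
    have "card ({..<m} \<inter> L) \<le> card L" "card ({..<m} \<inter> R) \<le> card R" "card ({..<m} \<inter> D) \<le> card D"
      by (rule card_mono; use finD in \<open>force simp: L_def R_def\<close>)+
    moreover have "card L \<le> card {w. w < m \<and> ow w \<noteq> 0 \<and> p w < g}"
      unfolding L_def by (rule card_image_le) simp
    ultimately show ?thesis by simp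
  qed
  also have "card {w. w < m \<and> ow w \<noteq> 0 \<and> p w < g} + card R
      = card ({w. w < m \<and> ow w \<noteq> 0 \<and> p w < g} \<union> R)"
    by (rule card_Un_disjoint[symmetric]) (auto simp: R_def)
  \<comment> \<open>Free vertices have price 0, which is below \<open>g\<close>; hence all of
    \<open>R\<close> is owned.\<close>
  also have "{w. w < m \<and> ow w \<noteq> 0 \<and> p w < g} \<union> R = ?M"
    using zero g(1) by (force simp: R_def)
  finally show "opt D \<le> 2 * card D + card ?M" by simp
next
  note owned = bidding_invD(5)[OF inv] and inj = bidding_invD(7)[OF inv]
  let ?M = "{w. w < m \<and> ow w \<noteq> 0}"
  obtain x where x: "hcover D x" "sum x {..<m} = opt D" by (rule opt_attained)
  let ?A = "{..<m} - D"
  have M: "ow w - 1 \<in> ?A" "w \<in> ?A" "2 \<le> x (ow w - 1) + x w" if "w \<in> ?M" for w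
  proof -
    obtain i where i: "ow w = Suc i" using \<open>w \<in> ?M\<close> not0_implies_Suc by blast
    then show "ow w - 1 \<in> ?A" "w \<in> ?A" "2 \<le> x (ow w - 1) + x w"
      using owned[of w i] \<open>w \<in> ?M\<close> x(1) by (auto simp: alive_def hcover_def)
  qed
  have inj: "inj_on (\<lambda>w. ow w - 1) ?M"
  proof (rule inj_onI)
    fix w w' assume "w \<in> ?M" "w' \<in> ?M" "ow w - 1 = ow w' - 1"
    then show "w = w'" using inj[of w w'] by auto
  qed
  \<comment> \<open>Weak duality: every matching edge has doubled value at least 2, and each vertex
    is at most once a left and once a right end.\<close>
  have "2 * card ?M = (\<Sum>w\<in>?M. 2)" by simp
  also have "\<dots> \<le> (\<Sum>w\<in>?M. x (ow w - 1) + x w)" using M(3) by (rule sum_mono)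
  also have "\<dots> = sum x ((\<lambda>w. ow w - 1) ` ?M) + sum x ?M"
    by (simp only: sum.distrib sum.reindex[OF inj] o_def)
  also have "\<dots> \<le> sum x ?A + sum x ?A"
    using M(1,2) by (intro add_mono sum_mono2) auto
  finally have "card ?M \<le> sum x ?A" by simp
  moreover have "2 * card D \<le> sum x D"
  proof -
    have "(\<Sum>i\<in>D. 2) \<le> sum x D" using x(1) by (intro sum_mono) (auto simp: hcover_def)
    then show ?thesis by simp
  qed
  moreover have "sum x {..<m} = sum x D + sum x ?A"
    using D sum.subset_diff[of D "{..<m}" x] by simp
  ultimately show "2 * card D + card ?M \<le> opt D" using x(2) by simp
qed

end

section \<open>Running time of programs\<close>

definition runs :: "com \<Rightarrow> store \<Rightarrow> nat \<Rightarrow> (store \<Rightarrow> bool) \<Rightarrow> bool" where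
  "runs p s T Q \<longleftrightarrow> (\<exists>t s'. exec p s t s' \<and> t \<le> T \<and> Q s')"

lemma exec_pos: "exec p s t s' \<Longrightarrow> 0 < t"
  by (induction rule: exec.induct) auto

text \<open>Determinism turns the existence of a run into an equivalence, so straight-line code can
  be executed symbolically by rewriting.\<close>

lemma runs_iff:
  assumes "exec p s t s'"
  shows "runs p s T Q \<longleftrightarrow> t \<le> T \<and> Q s'"
  unfolding runs_def using assms exec_deterministic[OF assms] by blast

lemma runs_mono:
  assumes "runs p s T Q" "T \<le> T'" "\<And>s'. Q s' \<Longrightarrow> Q' s'"
  shows "runs p s T' Q'"
  using assms unfolding runs_def by (meson order_trans)

lemma runs_seq:
  assumes "runs p s T (\<lambda>s'. runs q s' T' Q)"
  shows "runs (Seq p q) s (T + T') Q"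
  using assms unfolding runs_def by (meson add_mono exec.Seq)

lemma runs_seqI:
  assumes "runs p s T P" "\<And>s'. P s' \<Longrightarrow> runs q s' T' Q" "T + T' \<le> U"
  shows "runs (Seq p q) s U Q"
  using assms(1,2) by (intro runs_mono[OF runs_seq assms(3)] runs_mono[OF assms(1)]) auto

lemma runs_Skip [simp]: "runs Skip s T Q \<longleftrightarrow> 1 \<le> T \<and> Q s"
  by (rule runs_iff[OF exec.Skip])

lemma runs_Put [simp]:
  "runs (Put x i a) s T Q \<longleftrightarrow> 1 \<le> T \<and> Q (s(x := (s x)(aval i s := aval a s)))"
  by (rule runs_iff[OF exec.Put])

text \<open>The cut-off in \<open>T - 1\<close> is harmless: every program takes at least one step,
  so a budget that is too small makes both sides false.\<close>

lemma runs_Seq_Skip [simp]: "runs (Seq Skip q) s T Q \<longleftrightarrow> runs q s (T - 1) Q"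
proof
  assume "runs (Seq Skip q) s T Q"
  then show "runs q s (T - 1) Q"
    unfolding runs_def by (fastforce elim!: exec_SeqE exec_SkipE)
next
  assume "runs q s (T - 1) Q"
  then obtain t s' where "exec q s t s'" "t \<le> T - 1" "Q s'" unfolding runs_def by blast
  moreover from this have "1 + t \<le> T" using exec_pos[of q s t s'] by linarith
  ultimately show "runs (Seq Skip q) s T Q"
    unfolding runs_def using exec.Seq[OF exec.Skip] by blast
qed

lemma runs_Seq_Put [simp]:
  "runs (Seq (Put x i a) q) s T Q \<longleftrightarrow> runs q (s(x := (s x)(aval i s := aval a s))) (T - 1) Q"
    (is "?L \<longleftrightarrow> runs q ?s _ _")
proof
  assume ?L
  then show "runs q ?s (T - 1) Q"
    unfolding runs_def by (fastforce elim!: exec_SeqE exec_PutE)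
next
  assume "runs q ?s (T - 1) Q"
  then obtain t s' where "exec q ?s t s'" "t \<le> T - 1" "Q s'" unfolding runs_def by blast
  moreover from this have "1 + t \<le> T" using exec_pos[of q ?s t s'] by linarith
  ultimately show ?L unfolding runs_def using exec.Seq[OF exec.Put] by blast
qed

lemma runs_Cond [simp]:
  "runs (Cond b p q) s T Q \<longleftrightarrow> (if bval b s then runs p s (T - 1) Q else runs q s (T - 1) Q)"
proof
  assume "runs (Cond b p q) s T Q"
  then show "if bval b s then runs p s (T - 1) Q else runs q s (T - 1) Q"
    unfolding runs_def by (fastforce elim!: exec_CondE)
next
  assume A: "if bval b s then runs p s (T - 1) Q else runs q s (T - 1) Q"
  let ?r = "if bval b s then p else q"
  from A obtain t s' where e: "exec ?r s t s'" "t \<le> T - 1" "Q s'" unfolding runs_def by (auto split: if_splits)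
  then have "Suc t \<le> T" using exec_pos[OF e(1)] by linarith
  moreover have "exec (Cond b p q) s (Suc t) s'"
    using e(1) exec.CondTrue exec.CondFalse by (cases "bval b s") auto
  ultimately show "runs (Cond b p q) s T Q" using e(3) unfolding runs_def by blast
qed

text \<open>Reassociation leaves the number of steps unchanged and exposes the first command to the
  other rewrite rules.\<close>

lemma runs_Seq_Seq [simp]: "runs (Seq (Seq p q) r) s T Q \<longleftrightarrow> runs (Seq p (Seq q r)) s T Q"
proof -
  have "exec (Seq (Seq p q) r) s t s' \<longleftrightarrow> exec (Seq p (Seq q r)) s t s'" for t s'
  proof
    assume "exec (Seq (Seq p q) r) s t s'"
    then obtain t1 t2 t3 s1 s2 where
      "exec p s t1 s1" "exec q s1 t2 s2" "exec r s2 t3 s'" "t = t1 + (t2 + t3)"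
      by (auto elim!: exec_SeqE)
    then show "exec (Seq p (Seq q r)) s t s'" using exec.Seq by metis
  next
    assume "exec (Seq p (Seq q r)) s t s'"
    then obtain t1 t2 t3 s1 s2 where
      "exec p s t1 s1" "exec q s1 t2 s2" "exec r s2 t3 s'" "t = (t1 + t2) + t3"
      by (auto elim!: exec_SeqE)
    then show "exec (Seq (Seq p q) r) s t s'" using exec.Seq by metis
  qed
  then show ?thesis unfolding runs_def by simp
qed

lemma runs_Seq_Cond [simp]:
  "runs (Seq (Cond b p q) r) s T Q \<longleftrightarrow> runs (Cond b (Seq p r) (Seq q r)) s T Q"
proof -
  have "exec (Seq (Cond b p q) r) s t s' \<longleftrightarrow> exec (Cond b (Seq p r) (Seq q r)) s t s'" for t s'
  proof
    assume "exec (Seq (Cond b p q) r) s t s'"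
    then show "exec (Cond b (Seq p r) (Seq q r)) s t s'"
      by (elim exec_CondE exec_SeqE) (metis add_Suc exec.CondFalse exec.CondTrue exec.Seq)+
  next
    assume "exec (Cond b (Seq p r) (Seq q r)) s t s'"
    then show "exec (Seq (Cond b p q) r) s t s'"
      by (elim exec_CondE exec_SeqE) (metis add_Suc exec.CondFalse exec.CondTrue exec.Seq)+
  qed
  then show ?thesis unfolding runs_def by simp
qed

text \<open>The rank \<open>V\<close> bounds the number of rounds; a round costs its test and at
  most \<open>B\<close> steps, and the last 1 is the failing test.\<close>

lemma runs_while:
  assumes "I s"
    and body: "\<And>s. I s \<Longrightarrow> bval b s \<Longrightarrow> runs p s B (\<lambda>s'. I s' \<and> V s' < V s)"
    and exit: "\<And>s. I s \<Longrightarrow> \<not> bval b s \<Longrightarrow> Q s"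
    and T: "V s * Suc B + 1 \<le> T"
  shows "runs (While b p) s T Q"
proof -
  have "runs (While b p) s (V s * Suc B + 1) Q"
    using assms(1)
  proof (induction "V s" arbitrary: s rule: less_induct)
    case less
    show ?case
    proof (cases "bval b s")
      case False
      then show ?thesis
        using exec.WhileFalse[OF False] exit[OF less.prems False] unfolding runs_def
        by (intro exI[of _ 1] exI[of _ s]) simp
    next
      case True
      obtain t s' where s': "exec p s t s'" "t \<le> B" "I s'" "V s' < V s"
        using body[OF less.prems True] unfolding runs_def by blast
      obtain t' s'' where s'': "exec (While b p) s' t' s''" "t' \<le> V s' * Suc B + 1" "Q s''"
        using less.hyps[OF s'(4,3)] unfolding runs_def by blast
      have "Suc (V s') * Suc B \<le> V s * Suc B" using s'(4) by (intro mult_le_mono1) simp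
      then have "Suc (t + t') \<le> V s * Suc B + 1" using s'(2) s''(2) by simp
      then show ?thesis
        using exec.WhileTrue[OF True s'(1) s''(1)] s''(3) unfolding runs_def by blast
    qed
  qed
  then show ?thesis using T by (rule runs_mono)
qed

section \<open>Counting loops and frame conditions\<close>

abbreviation var :: "string \<Rightarrow> aexp" where
  "var x \<equiv> Get x (Const 0)"

abbreviation assign :: "string \<Rightarrow> aexp \<Rightarrow> com" (infix "::=" 61) where
  "x ::= a \<equiv> Put x (Const 0) a"

notation Seq (infixr ";;" 60)

abbreviation edge_count :: aexp where
  "edge_count \<equiv> Get ''in'' (Const 1)"

definition For :: "string \<Rightarrow> com \<Rightarrow> com" where
  "For x p = x ::= Const 0 ;; While (Less (var x) edge_count) (p ;; x ::= Add (var x) (Const 1))"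

text \<open>The invariant at index \<open>k\<close> describes the head of round \<open>k\<close>. A
  round adds a test and an increment to \<open>B\<close>; initialization and the failing test give
  the final 2.\<close>

lemma runs_For:
  assumes "I 0 (s(x := (s x)(0 := 0)))" and m: "s ''in'' 1 = m" and x: "x \<noteq> ''in''"
    and body: "\<And>k s. k < m \<Longrightarrow> s ''in'' 1 = m \<Longrightarrow> s x 0 = k \<Longrightarrow> I k s \<Longrightarrow>
      runs p s B (\<lambda>s'. s' ''in'' 1 = m \<and> s' x 0 = k \<and> I (Suc k) (s'(x := (s' x)(0 := Suc k))))"
    and exit: "\<And>s. I m s \<Longrightarrow> Q s"
    and T: "m * (B + 2) + 2 \<le> T"
  shows "runs (For x p) s T Q"
proof -
  let ?s = "s(x := (s x)(0 := 0))"
  let ?J = "\<lambda>s. s ''in'' 1 = m \<and> s x 0 \<le> m \<and> I (s x 0) s"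
  have "runs (While (Less (var x) edge_count) (p ;; x ::= Add (var x) (Const 1))) ?s (T - 1) Q"
  proof (rule runs_while[where I = ?J and B = "B + 1" and V = "\<lambda>s. m - s x 0"])
    show "?J ?s" using assms(1) m x by simp
    fix s assume J: "?J s"
    {
      assume "bval (Less (var x) edge_count) s"
      then have k: "s x 0 < m" using J by simp
      show "runs (p ;; x ::= Add (var x) (Const 1)) s (B + 1) (\<lambda>s'. ?J s' \<and> m - s' x 0 < m - s x 0)"
        by (rule runs_seq, rule runs_mono[OF body[where k = "s x 0"]]) (use J k x in auto)
    next
      assume "\<not> bval (Less (var x) edge_count) s"
      then have "s x 0 = m" using J by simp
      then show "Q s" using J exit by metis
    }
  qed (use T x in simp)
  then show ?thesis by (simp add: For_def)
qed

definition agree :: "string set \<Rightarrow> store \<Rightarrow> store \<Rightarrow> bool" where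
  "agree W s s' \<longleftrightarrow> (\<forall>y. y \<notin> W \<longrightarrow> s' y = s y)"

lemma agreeD: "agree W s s' \<Longrightarrow> y \<notin> W \<Longrightarrow> s' y = s y"
  by (simp add: agree_def)

lemma agree_refl [simp]: "agree W s s"
  by (simp add: agree_def)

lemma agree_upd [simp]: "x \<in> W \<Longrightarrow> agree W s (s'(x := f)) \<longleftrightarrow> agree W s s'"
  by (auto simp: agree_def)

lemma agree_trans: "agree W s s' \<Longrightarrow> agree W' s' s'' \<Longrightarrow> W' \<subseteq> W \<Longrightarrow> agree W s s''"
  unfolding agree_def by (metis subsetD)

section \<open>The program\<close>

text \<open>
  In an input word, entry 0 is the number of vertices and entry 1 the number of edges; the three
  header entries and the vertices are followed by a block of three entries for each edge.
\<close>

definition src :: "(nat \<Rightarrow> nat) \<Rightarrow> nat \<Rightarrow> nat" where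
  "src inp i = inp (3 + inp 0 + (i + (i + i)))"

definition tgt :: "(nat \<Rightarrow> nat) \<Rightarrow> nat \<Rightarrow> nat" where
  "tgt inp i = inp (4 + inp 0 + (i + (i + i)))"

definition col :: "(nat \<Rightarrow> nat) \<Rightarrow> nat \<Rightarrow> nat" where
  "col inp i = inp (5 + inp 0 + (i + (i + i)))"

definition conflict :: "(nat \<Rightarrow> nat) \<Rightarrow> nat \<Rightarrow> nat \<Rightarrow> bool" where
  "conflict inp i j \<longleftrightarrow> col inp i \<noteq> col inp j \<and>
     (src inp i = src inp j \<or> src inp i = tgt inp j \<or> tgt inp i = src inp j \<or> tgt inp i = tgt inp j)"

interpretation cg: conflict_graph "inp 1" "conflict inp" for inp
  by unfold_locales (auto simp: conflict_def)

text \<open>Without multiplication, the offset of a block of three is formed by repeated addition;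
  \<open>k\<close> is 3, 4 or 5 for source, target or color.\<close>

definition fieldE :: "nat \<Rightarrow> aexp \<Rightarrow> aexp" where
  "fieldE k a = Get ''in'' (Add (Add (Const k) (Get ''in'' (Const 0))) (Add a (Add a a)))"

definition EqE :: "aexp \<Rightarrow> aexp \<Rightarrow> bexp" where
  "EqE a b = Conj (Neg (Less a b)) (Neg (Less b a))"

lemma bval_EqE [simp]: "bval (EqE a b) s \<longleftrightarrow> aval a s = aval b s"
  by (auto simp: EqE_def)

definition OrE :: "bexp \<Rightarrow> bexp \<Rightarrow> bexp" where
  "OrE a b = Neg (Conj (Neg a) (Neg b))"

lemma bval_OrE [simp]: "bval (OrE a b) s \<longleftrightarrow> bval a s \<or> bval b s"
  by (simp add: OrE_def)

definition conflictE :: "aexp \<Rightarrow> aexp \<Rightarrow> bexp" where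
  "conflictE a b = Conj (Neg (EqE (fieldE 5 a) (fieldE 5 b)))
     (OrE (OrE (EqE (fieldE 3 a) (fieldE 3 b)) (EqE (fieldE 3 a) (fieldE 4 b)))
          (OrE (EqE (fieldE 4 a) (fieldE 3 b)) (EqE (fieldE 4 a) (fieldE 4 b))))"

lemma bval_conflictE [simp]:
  "bval (conflictE a b) s \<longleftrightarrow> conflict (s ''in'') (aval a s) (aval b s)"
  by (simp add: conflictE_def fieldE_def conflict_def src_def tgt_def col_def)

section \<open>The auction as a program\<close>

definition init_com :: "string \<Rightarrow> com" where
  "init_com X = ''val'' ::= Const 0 ;;
     For ''j'' (Put ''p'' (var ''j'') (Const 0) ;; Put ''o'' (var ''j'') (Const 0) ;;
       Cond (Less (Const 0) (Get X (var ''j''))) (''val'' ::= Add (var ''val'') (Const 2)) Skip)"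

text \<open>Starting \<open>best\<close> at \<open>m + 1\<close> merges the absence of neighbors
  with neighbors that all cost more than \<open>m\<close>; \<open>b\<close> is meaningful only if
  \<open>best\<close> ends at most \<open>m\<close>.\<close>

definition cheapest_com :: "string \<Rightarrow> com" where
  "cheapest_com X = ''best'' ::= Add edge_count (Const 1) ;;
     For ''j''
       (Cond (Conj (Conj (conflictE (var ''u'') (var ''j''))
           (Conj (EqE (Get X (var ''u'')) (Const 0)) (EqE (Get X (var ''j'')) (Const 0))))
           (Less (Get ''p'' (var ''j'')) (var ''best'')))
         (''b'' ::= var ''j'' ;; ''best'' ::= Get ''p'' (var ''j'')) Skip)"

definition next_com :: com where
  "next_com = ''u'' ::= var ''c'' ;; ''c'' ::= Add (var ''c'') (Const 1)"

text \<open>The outcomes match \<open>bidding_drop\<close>, \<open>bidding_bid_displace\<close> and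
  \<open>bidding_bid_free\<close>; only in the last does the matching, and with it
  \<open>val\<close>, grow.\<close>

definition bid_com :: com where
  "bid_com = Cond (Less edge_count (var ''best'')) next_com
     (''old'' ::= Get ''o'' (var ''b'') ;;
      Put ''o'' (var ''b'') (Add (var ''u'') (Const 1)) ;;
      Put ''p'' (var ''b'') (Add (Get ''p'' (var ''b'')) (Const 1)) ;;
      Cond (Less (Const 0) (var ''old''))
        (''u'' ::= Sub (var ''old'') (Const 1))
        (''val'' ::= Add (var ''val'') (Const 1) ;; next_com))"

definition auction_com :: "string \<Rightarrow> com" where
  "auction_com X = init_com X ;; ''u'' ::= Const 0 ;; ''c'' ::= Const 1 ;;
     While (Less (var ''u'') edge_count) (cheapest_com X ;; bid_com)"

definition auction_vars :: "string set" where
  "auction_vars = {''val'', ''j'', ''p'', ''o'', ''u'', ''c'', ''b'', ''best'', ''old''}"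

definition ones :: "(nat \<Rightarrow> nat) \<Rightarrow> (nat \<Rightarrow> nat) \<Rightarrow> nat set" where
  "ones inp x = {i. i < inp 1 \<and> x i \<noteq> 0}"

lemma ones_subset: "ones inp x \<subseteq> {..<inp 1}"
  by (auto simp: ones_def)

lemma card_less_Suc:
  "card {i. i < Suc k \<and> P i} = card {i. i < k \<and> P i} + (if P k then 1 else 0)"
proof -
  have "{i. i < Suc k \<and> P i} = (if P k then insert k {i. i < k \<and> P i} else {i. i < k \<and> P i})"
    by (auto simp: less_Suc_eq)
  then show ?thesis by simp
qed

lemma runs_init:
  assumes "s ''in'' = inp" "X \<notin> auction_vars"
  shows "runs (init_com X) s (6 * inp 1 + 3)
    (\<lambda>s'. agree auction_vars s s' \<and> (\<forall>w < inp 1. s' ''p'' w = 0 \<and> s' ''o'' w = 0) \<and>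
       s' ''val'' 0 = 2 * card (ones inp (s X)))"
proof -
  let ?I = "\<lambda>k s'. agree auction_vars s s' \<and> (\<forall>w < k. s' ''p'' w = 0 \<and> s' ''o'' w = 0) \<and>
       s' ''val'' 0 = 2 * card {i. i < k \<and> s X i \<noteq> 0}"
  show ?thesis
    unfolding init_com_def runs_Seq_Put
    apply (rule runs_For[where I = ?I and B = 4 and m = "inp 1"])
    subgoal by (simp add: auction_vars_def)
    subgoal using assms by simp
    subgoal by simp
    subgoal for k s'
      using assms agreeD[of auction_vars s s' "''in''"] agreeD[of auction_vars s s' X]
      by (auto simp: auction_vars_def card_less_Suc less_Suc_eq[of _ "s' ''j'' 0"])
    subgoal by (simp add: ones_def)
    subgoal by simp
    done
qed

lemma runs_cheapest:
  assumes "s ''in'' = inp" "X \<notin> auction_vars" "s ''u'' 0 < inp 1"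
  shows "runs (cheapest_com X) s (5 * inp 1 + 3)
    (\<lambda>s'. agree {''j'', ''best'', ''b''} s s' \<and>
       (\<forall>j < inp 1. cg.alive inp (ones inp (s X)) (s ''u'' 0) j \<longrightarrow> s' ''best'' 0 \<le> s ''p'' j) \<and>
       (s' ''best'' 0 \<le> inp 1 \<longrightarrow> s' ''b'' 0 < inp 1 \<and> s' ''best'' 0 = s ''p'' (s' ''b'' 0) \<and>
          cg.alive inp (ones inp (s X)) (s ''u'' 0) (s' ''b'' 0)))"
proof -
  let ?D = "ones inp (s X)"
  let ?I = "\<lambda>k s'. agree {''j'', ''best'', ''b''} s s' \<and>
       (\<forall>j < k. cg.alive inp ?D (s ''u'' 0) j \<longrightarrow> s' ''best'' 0 \<le> s ''p'' j) \<and>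
       (s' ''best'' 0 \<le> inp 1 \<longrightarrow> s' ''b'' 0 < inp 1 \<and> s' ''best'' 0 = s ''p'' (s' ''b'' 0) \<and>
          cg.alive inp ?D (s ''u'' 0) (s' ''b'' 0))"
  show ?thesis
    unfolding cheapest_com_def runs_Seq_Put
    apply (rule runs_For[where I = ?I and B = 3 and m = "inp 1"])
    subgoal using assms by (simp)
    subgoal using assms by simp
    subgoal by simp
    subgoal premises prems for k s'
    proof -
      have X: "X \<noteq> ''j''" "X \<noteq> ''best''" "X \<noteq> ''b''" using assms(2) by (auto simp: auction_vars_def)
      have ag: "agree {''j'', ''best'', ''b''} s s'" using prems(4) by simp
      have e: "s' ''in'' = inp" "s' X = s X" "s' ''u'' = s ''u''" "s' ''p'' = s ''p''"
        using agreeD[OF ag] X assms(1) by auto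
      have "cg.alive inp ?D (s ''u'' 0) k \<longleftrightarrow> conflict inp (s ''u'' 0) k \<and> s X (s ''u'' 0) = 0 \<and> s X k = 0"
        using prems(1) assms(3) by (auto simp: cg.alive_def ones_def)
      then show ?thesis using prems X e by (auto simp: less_Suc_eq)
    qed
    subgoal by simp
    subgoal by simp
    done
qed

lemma sum_decrease:
  fixes f g :: "nat \<Rightarrow> nat"
  assumes "b < m" "g b < f b" "\<And>w. w \<noteq> b \<Longrightarrow> g w = f w"
  shows "sum g {..<m} < sum f {..<m}"
proof (rule sum_strict_mono_ex1)
  show "\<forall>w\<in>{..<m}. g w \<le> f w" using assms(2,3) by (metis le_less)
  show "\<exists>w\<in>{..<m}. g w < f w" using assms(1,2) by auto
qed simp

text \<open>The last clause makes \<open>val\<close> equal to \<open>opt D\<close> by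
  \<open>bidding_opt\<close> once no bidder is left. The middle one leaves room to advance
  \<open>c\<close>.\<close>

definition auction_inv :: "(nat \<Rightarrow> nat) \<Rightarrow> nat set \<Rightarrow> store \<Rightarrow> bool" where
  "auction_inv inp D s \<longleftrightarrow> cg.bidding_inv inp D (s ''u'' 0) (s ''c'' 0) (s ''p'') (s ''o'') \<and>
     (s ''u'' 0 < inp 1 \<longrightarrow> s ''c'' 0 \<le> inp 1) \<and>
     s ''val'' 0 = 2 * card D + card {w. w < inp 1 \<and> s ''o'' w \<noteq> 0}"

text \<open>Every round raises a price or advances \<open>c\<close>, and none of these quantities
  exceeds \<open>m + 1\<close>.\<close>

definition auction_rank :: "(nat \<Rightarrow> nat) \<Rightarrow> store \<Rightarrow> nat" where
  "auction_rank inp s = (\<Sum>w < inp 1. Suc (inp 1) - s ''p'' w) + (Suc (inp 1) - s ''c'' 0)"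

lemma runs_bid:
  assumes inp: "s ''in'' = inp" and inv: "auction_inv inp D s" and u: "s ''u'' 0 < inp 1"
    and b: "\<forall>j < inp 1. cg.alive inp D (s ''u'' 0) j \<longrightarrow> s ''best'' 0 \<le> s ''p'' j"
      "s ''best'' 0 \<le> inp 1 \<longrightarrow> s ''b'' 0 < inp 1 \<and> s ''best'' 0 = s ''p'' (s ''b'' 0) \<and>
          cg.alive inp D (s ''u'' 0) (s ''b'' 0)"
  shows "runs bid_com s 8 (\<lambda>s'. agree (auction_vars) s s' \<and>
     auction_inv inp D s' \<and> auction_rank inp s' < auction_rank inp s)"
proof (cases "inp 1 < s ''best'' 0")
  case True
  have c: "s ''c'' 0 \<le> inp 1" using inv u by (simp add: auction_inv_def)
  have "cg.bidding_inv inp D (s ''c'' 0) (Suc (s ''c'' 0)) (s ''p'') (s ''o'')"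
    using inv u c b(1) True by (intro cg.bidding_drop) (auto simp: auction_inv_def dest: less_le_trans)
  then show ?thesis
    using True inv c inp
    by (auto simp: bid_com_def next_com_def auction_inv_def auction_rank_def auction_vars_def)
next
  case False
  let ?m = "inp 1" and ?b = "s ''b'' 0" and ?p = "s ''p''" and ?ow = "s ''o''"
    and ?u = "s ''u'' 0" and ?c = "s ''c'' 0"
  let ?p' = "?p(?b := Suc (?p ?b))" and ?ow' = "?ow(?b := Suc ?u)"
  have v: "s ''val'' 0 = 2 * card D + card {w. w < ?m \<and> ?ow w \<noteq> 0}"
    and ai: "cg.bidding_inv inp D ?u ?c ?p ?ow" and c: "?c \<le> ?m"
    using inv u by (auto simp: auction_inv_def)
  have bm: "?b < ?m" "s ''best'' 0 = ?p ?b" "cg.alive inp D ?u ?b" "?p ?b \<le> ?m"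
    and min: "\<forall>j<?m. cg.alive inp D ?u j \<longrightarrow> ?p ?b \<le> ?p j"
    using False b by auto
  \<comment> \<open>Strict because \<open>p b \<le> m\<close>, so the cut-off difference for
    \<open>b\<close> was still positive.\<close>
  have dec: "(\<Sum>w<?m. Suc ?m - ?p' w) < (\<Sum>w<?m. Suc ?m - ?p w)"
    using bm by (intro sum_decrease[of ?b]) auto
  have le: "Suc ?m - Suc ?c \<le> Suc ?m - ?c" by simp
  have M: "{w. w < ?m \<and> ?ow' w \<noteq> 0} = insert ?b {w. w < ?m \<and> ?ow w \<noteq> 0}" using bm(1) by auto
  show ?thesis
  proof (cases "?ow ?b")
    case 0
    define s' where "s' = s(''old'' := (s ''old'')(0 := 0), ''o'' := ?ow', ''p'' := ?p',
      ''val'' := (s ''val'')(0 := Suc (s ''val'' 0)), ''u'' := (s ''u'')(0 := ?c), ''c'' := (s ''c'')(0 := Suc ?c))"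
    have "cg.bidding_inv inp D ?c (Suc ?c) ?p' ?ow'"
      using ai u c bm min 0 by (intro cg.bidding_bid_free)
    moreover have "card {w. w < ?m \<and> ?ow' w \<noteq> 0} = Suc (card {w. w < ?m \<and> ?ow w \<noteq> 0})"
      unfolding M using 0 by simp
    ultimately have "auction_inv inp D s'"
      using v c unfolding auction_inv_def s'_def by simp
    moreover have "auction_rank inp s' < auction_rank inp s"
      using add_less_le_mono[OF dec le] unfolding auction_rank_def s'_def by simp
    moreover have "agree auction_vars s s'" unfolding s'_def by (simp add: auction_vars_def)
    moreover have "runs bid_com s 8 (\<lambda>t. t = s')"
      using False 0 inp by (simp add: bid_com_def next_com_def s'_def)
    ultimately show ?thesis by (auto elim: runs_mono)
  next
    case (Suc i')
    define s' where "s' = s(''old'' := (s ''old'')(0 := Suc i'), ''o'' := ?ow', ''p'' := ?p',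
      ''u'' := (s ''u'')(0 := i'))"
    have "cg.bidding_inv inp D i' ?c ?p' ?ow'" "i' < ?m"
      using cg.bidding_bid_displace[OF ai u bm(1,3,4) min Suc] by auto
    moreover have "{w. w < ?m \<and> ?ow' w \<noteq> 0} = {w. w < ?m \<and> ?ow w \<noteq> 0}"
      unfolding M using bm(1) Suc by auto
    ultimately have "auction_inv inp D s'"
      using v c unfolding auction_inv_def s'_def by simp
    moreover have "auction_rank inp s' < auction_rank inp s"
      using dec unfolding auction_rank_def s'_def by simp
    moreover have "agree auction_vars s s'" unfolding s'_def by (simp add: auction_vars_def)
    moreover have "runs bid_com s 8 (\<lambda>t. t = s')"
      using False Suc inp by (simp add: bid_com_def next_com_def s'_def)
    ultimately show ?thesis by (auto elim: runs_mono)
  qed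
qed

text \<open>The initial rank is at most \<open>m * Suc m + m\<close>; a round costs
  \<open>5 * m + 3\<close> for the search, 8 for the bid and 1 for the test.\<close>

definition auction_time :: "nat \<Rightarrow> nat" where
  "auction_time m = 6 * m + 6 + (m * Suc m + m) * (5 * m + 12)"

lemma runs_auction:
  assumes inp: "s ''in'' = inp" and X: "X \<notin> auction_vars"
  shows "runs (auction_com X) s (auction_time (inp 1))
    (\<lambda>s'. agree auction_vars s s' \<and> s' ''val'' 0 = cg.opt inp (ones inp (s X)))"
proof -
  let ?D = "ones inp (s X)" and ?m = "inp 1"
  let ?Q = "\<lambda>s'. agree auction_vars s s' \<and> s' ''val'' 0 = cg.opt inp ?D"
  let ?W = "While (Less (var ''u'') edge_count) (cheapest_com X ;; bid_com)"
  let ?J = "\<lambda>s'. agree auction_vars s s' \<and> auction_inv inp ?D s'"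
  have sub: "?D \<subseteq> {..<?m}" by (rule ones_subset)
  have inX: "''in'' \<notin> auction_vars" by (simp add: auction_vars_def)
  have loop: "runs ?W s' ((?m * Suc ?m + ?m) * (5 * ?m + 12) + 1) ?Q"
    if J: "?J s'" and r: "auction_rank inp s' \<le> ?m * Suc ?m + ?m" for s'
  proof (rule runs_while[where I = ?J and B = "5 * ?m + 11" and V = "auction_rank inp"])
    show "?J s'" by fact
    fix t assume t: "?J t"
    have t_in: "t ''in'' = inp" and tX: "t X = s X"
      using t agreeD inX X inp by metis+
    {
      assume "bval (Less (var ''u'') edge_count) t"
      then have u: "t ''u'' 0 < ?m" using t_in by simp
      have bid: "runs bid_com t' 8 (\<lambda>s'. ?J s' \<and> auction_rank inp s' < auction_rank inp t)"
        if ag: "agree {''j'', ''best'', ''b''} t t'"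
          and h: "\<forall>j < ?m. cg.alive inp ?D (t ''u'' 0) j \<longrightarrow> t' ''best'' 0 \<le> t ''p'' j"
            "t' ''best'' 0 \<le> ?m \<longrightarrow> t' ''b'' 0 < ?m \<and> t' ''best'' 0 = t ''p'' (t' ''b'' 0) \<and>
              cg.alive inp ?D (t ''u'' 0) (t' ''b'' 0)" for t'
      proof -
        have e: "t' ''in'' = inp" "t' ''u'' = t ''u''" "t' ''c'' = t ''c''" "t' ''p'' = t ''p''"
          "t' ''o'' = t ''o''" "t' ''val'' = t ''val''"
          using agreeD[OF ag] t_in by auto
        have inv: "auction_inv inp ?D t'" and rank: "auction_rank inp t' = auction_rank inp t"
          using t e by (auto simp: auction_inv_def auction_rank_def)
        have u': "t' ''u'' 0 < ?m" using u e(2) by simp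
        have "agree auction_vars s t'"
          by (rule agree_trans[OF conjunct1[OF t] ag]) (simp add: auction_vars_def)
        then have "agree auction_vars s s'" if "agree auction_vars t' s'" for s'
          using that by (rule agree_trans) simp
        moreover have "runs bid_com t' 8 (\<lambda>s'. agree auction_vars t' s' \<and>
            auction_inv inp ?D s' \<and> auction_rank inp s' < auction_rank inp t')"
          using h by (intro runs_bid[OF e(1) inv u']) (simp_all only: e)
        ultimately show ?thesis unfolding rank by (blast intro: runs_mono[OF _ order_refl])
      qed
      have "runs (cheapest_com X) t (5 * ?m + 3)
          (\<lambda>t'. runs bid_com t' 8 (\<lambda>s'. ?J s' \<and> auction_rank inp s' < auction_rank inp t))"
        by (rule runs_mono[OF runs_cheapest[of t inp X, OF t_in X u] order_refl], unfold tX, elim conjE)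
          (rule bid)
      then have "runs (cheapest_com X ;; bid_com) t (5 * ?m + 3 + 8)
          (\<lambda>s'. ?J s' \<and> auction_rank inp s' < auction_rank inp t)"
        by (rule runs_seq)
      then show "runs (cheapest_com X ;; bid_com) t (5 * ?m + 11)
          (\<lambda>s'. ?J s' \<and> auction_rank inp s' < auction_rank inp t)"
        by (rule runs_mono) auto
    next
      assume "\<not> bval (Less (var ''u'') edge_count) t"
      then have "?m \<le> t ''u'' 0" using t_in by simp
      then show "?Q t"
        using t cg.bidding_opt[of inp ?D "t ''u'' 0" "t ''c'' 0" "t ''p''" "t ''o''", OF _ _ sub]
        unfolding auction_inv_def by simp
    }
  next
    have "Suc (5 * ?m + 11) = 5 * ?m + 12" by simp
    then show "auction_rank inp s' * Suc (5 * ?m + 11) + 1 \<le> (?m * Suc ?m + ?m) * (5 * ?m + 12) + 1"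
      using mult_le_mono1[OF r, of "5 * ?m + 12"] by presburger
  qed
  have rest: "runs (''u'' ::= Const 0 ;; ''c'' ::= Const 1 ;; ?W) s'
      (2 + ((?m * Suc ?m + ?m) * (5 * ?m + 12) + 1)) ?Q"
    if "agree auction_vars s s'" "\<forall>w < ?m. s' ''p'' w = 0 \<and> s' ''o'' w = 0"
      "s' ''val'' 0 = 2 * card ?D" for s'
  proof -
    let ?s = "s'(''u'' := (s' ''u'')(0 := 0), ''c'' := (s' ''c'')(0 := 1))"
    have no: "{w. w < ?m \<and> s' ''o'' w \<noteq> 0} = {}" using that by auto
    have "(\<Sum>w<?m. Suc ?m - s' ''p'' w) = (\<Sum>w<?m. Suc ?m)"
      using that by (intro sum.cong) auto
    moreover have "cg.bidding_inv inp ?D 0 1 (s' ''p'') (s' ''o'')"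
      using that by (intro cg.bidding_init) simp
    moreover have "card {w. w < ?m \<and> s' ''o'' w \<noteq> 0} = 0" unfolding no by simp
    ultimately have "auction_inv inp ?D ?s" "auction_rank inp ?s \<le> ?m * Suc ?m + ?m"
      using that by (simp_all add: auction_inv_def auction_rank_def)
    moreover have "agree auction_vars s ?s" using that by (simp add: auction_vars_def)
    ultimately have "runs ?W ?s ((?m * Suc ?m + ?m) * (5 * ?m + 12) + 1) ?Q"
      by (intro loop conjI)
    then show ?thesis by simp
  qed
  show ?thesis
    unfolding auction_com_def
    by (rule runs_seqI[OF runs_init[of s inp X, OF inp X]], elim conjE, rule rest)
      (simp_all add: auction_time_def)
qed

section \<open>One branching step as a program\<close>

definition step_vars :: "string set" where
  "step_vars = auction_vars \<union> {''d'', ''e'', ''f'', ''i'', ''cur'', ''ve'', ''pick'', ''h''}"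

text \<open>The arrays \<open>e\<close> and \<open>f\<close> hold the two alternatives for
  \<open>v\<close>, to be compared with \<open>d\<close> by their bounds.\<close>

definition candidates_com :: com where
  "candidates_com =
     For ''i'' (Put ''e'' (var ''i'') (Get ''d'' (var ''i'')) ;;
       Cond (conflictE (var ''v'') (var ''i''))
         (Put ''f'' (var ''i'') (Const 1)) (Put ''f'' (var ''i'') (Get ''d'' (var ''i'')))) ;;
     Put ''e'' (var ''v'') (Const 1)"

text \<open>The values 0 and 1 of \<open>pick\<close> select \<open>e\<close> and \<open>f\<close>.
  The lowest bit of \<open>h\<close> is obtained by subtracting twice its half.\<close>

definition pick_com :: com where
  "pick_com = Cond (EqE (var ''ve'') (var ''cur'')) (''pick'' ::= Const 0)
     (Cond (EqE (var ''val'') (var ''cur'')) (''pick'' ::= Const 1)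
       (''pick'' ::= Sub (var ''h'') (Add (Half (var ''h'')) (Half (var ''h''))) ;;
        ''h'' ::= Half (var ''h'')))"

definition commit_com :: com where
  "commit_com = For ''i'' (Cond (Less (Const 0) (var ''pick''))
     (Put ''d'' (var ''i'') (Get ''f'' (var ''i''))) (Put ''d'' (var ''i'') (Get ''e'' (var ''i''))))"

definition step_com :: com where
  "step_com = auction_com ''d'' ;; ''cur'' ::= var ''val'' ;; candidates_com ;;
     auction_com ''e'' ;; ''ve'' ::= var ''val'' ;; auction_com ''f'' ;; pick_com ;; commit_com"

lemma runs_candidates:
  assumes inp: "s ''in'' = inp" and v: "s ''v'' 0 < inp 1"
  shows "runs candidates_com s (5 * inp 1 + 3) (\<lambda>s'. agree {''e'', ''f'', ''i''} s s' \<and>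
     ones inp (s' ''e'') = insert (s ''v'' 0) (ones inp (s ''d'')) \<and>
     ones inp (s' ''f'') = ones inp (s ''d'') \<union> cg.nbrs inp (s ''v'' 0))"
proof -
  let ?v = "s ''v'' 0"
  let ?I = "\<lambda>k s'. agree {''e'', ''f'', ''i''} s s' \<and> (\<forall>j<k. s' ''e'' j = s ''d'' j \<and>
     s' ''f'' j = (if conflict inp ?v j then 1 else s ''d'' j))"
  have "runs (For ''i'' (Put ''e'' (var ''i'') (Get ''d'' (var ''i'')) ;;
       Cond (conflictE (var ''v'') (var ''i''))
         (Put ''f'' (var ''i'') (Const 1)) (Put ''f'' (var ''i'') (Get ''d'' (var ''i''))))) s
       (5 * inp 1 + 2) (?I (inp 1))"
    apply (rule runs_For[where I = ?I and B = 3 and m = "inp 1"])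
    subgoal by simp
    subgoal using inp by simp
    subgoal by simp
    subgoal for k t
      using inp agreeD[of "{''e'', ''f'', ''i''}" s t "''in''"]
        agreeD[of "{''e'', ''f'', ''i''}" s t "''v''"] agreeD[of "{''e'', ''f'', ''i''}" s t "''d''"]
      by (auto simp: less_Suc_eq)
    subgoal by simp
    subgoal by simp
    done
  then show ?thesis
    unfolding candidates_com_def
  proof (rule runs_seqI[where T' = 1])
    fix t assume t: "?I (inp 1) t"
    then have "t ''v'' = s ''v''" by (simp add: agree_def)
    then show "runs (Put ''e'' (var ''v'') (Const 1)) t 1 (\<lambda>s'. agree {''e'', ''f'', ''i''} s s' \<and>
       ones inp (s' ''e'') = insert (s ''v'' 0) (ones inp (s ''d'')) \<and>
       ones inp (s' ''f'') = ones inp (s ''d'') \<union> cg.nbrs inp (s ''v'' 0))"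
      using t v unfolding ones_def cg.nbrs_def by auto
  qed simp
qed

lemma runs_pick:
  "runs pick_com s 4 (\<lambda>s'. agree {''pick'', ''h''} s s' \<and>
     (s' ''pick'' 0, s' ''h'' 0) =
       (if s ''ve'' 0 = s ''cur'' 0 then (0, s ''h'' 0)
        else if s ''val'' 0 = s ''cur'' 0 then (1, s ''h'' 0)
        else (s ''h'' 0 mod 2, s ''h'' 0 div 2)))"
proof -
  have "h - (h div 2 + h div 2) = h mod 2" for h :: nat by presburger
  then show ?thesis by (simp add: pick_com_def)
qed

lemma runs_commit:
  assumes inp: "s ''in'' = inp"
  shows "runs commit_com s (4 * inp 1 + 2) (\<lambda>s'. agree {''d'', ''i''} s s' \<and>
     ones inp (s' ''d'') = (if 0 < s ''pick'' 0 then ones inp (s ''f'') else ones inp (s ''e'')))"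
proof -
  let ?I = "\<lambda>k s'. agree {''d'', ''i''} s s' \<and>
    (\<forall>j<k. s' ''d'' j = (if 0 < s ''pick'' 0 then s ''f'' j else s ''e'' j))"
  show ?thesis
    unfolding commit_com_def
    apply (rule runs_For[where I = ?I and B = 2 and m = "inp 1"])
    subgoal by simp
    subgoal using inp by simp
    subgoal by simp
    subgoal for k t
      using inp agreeD[of "{''d'', ''i''}" s t "''in''"] agreeD[of "{''d'', ''i''}" s t "''pick''"]
        agreeD[of "{''d'', ''i''}" s t "''e''"] agreeD[of "{''d'', ''i''}" s t "''f''"]
      by (auto simp: less_Suc_eq)
    subgoal by (auto simp: ones_def)
    subgoal by simp
    done
qed

definition step_time :: "nat \<Rightarrow> nat" where
  "step_time m = 3 * auction_time m + 9 * m + 11"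

lemma runs_step:
  assumes inp: "s ''in'' = inp" and v: "s ''v'' 0 < inp 1"
  shows "runs step_com s (step_time (inp 1)) (\<lambda>s'. agree step_vars s s' \<and>
     (ones inp (s' ''d''), s' ''h'' 0) = cg.decide inp (s ''v'' 0) (ones inp (s ''d''), s ''h'' 0))"
    (is "runs _ _ _ ?Q")
proof -
  let ?m = "inp 1" and ?v = "s ''v'' 0" and ?D = "ones inp (s ''d'')"
  let ?A = "auction_time ?m"
  have sub: "auction_vars \<subseteq> step_vars" "{''e'', ''f'', ''i''} \<subseteq> step_vars"
    "{''pick'', ''h''} \<subseteq> step_vars" "{''d'', ''i''} \<subseteq> step_vars"
    "''cur'' \<in> step_vars" "''ve'' \<in> step_vars"
    by (auto simp: step_vars_def)
  have nin: "''d'' \<notin> auction_vars" "''e'' \<notin> auction_vars" "''f'' \<notin> auction_vars" "''in'' \<notin> auction_vars"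
    "''v'' \<notin> auction_vars" "''h'' \<notin> auction_vars" "''cur'' \<notin> auction_vars" "''ve'' \<notin> auction_vars"
    by (auto simp: auction_vars_def)
  show ?thesis
    unfolding step_com_def
  proof (rule runs_seqI[OF runs_auction[of s inp "''d''", OF inp nin(1)], where T' = "2 * ?A + 9 * ?m + 11"])
    \<comment> \<open>The stores \<open>s1\<close> to \<open>s6\<close> follow the commands in
      order; the facts \<open>g1\<close> to \<open>g5\<close> track the frame, \<open>e1\<close> to
      \<open>e5\<close> the arrays still needed.\<close>
    fix s1 assume s1: "agree auction_vars s s1 \<and> s1 ''val'' 0 = cg.opt inp ?D"
    let ?s1 = "s1(''cur'' := (s1 ''cur'')(0 := s1 ''val'' 0))"
    have g1: "agree step_vars s ?s1"
      using s1 sub by (auto intro: agree_trans[of _ s s])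
    have e1: "?s1 ''in'' = inp" "?s1 ''v'' = s ''v''" "?s1 ''d'' = s ''d''" "?s1 ''h'' = s ''h''"
      using s1 nin inp by (auto simp: agree_def)
    have v1: "?s1 ''v'' 0 < ?m" using v e1(2) by simp
    have "runs (candidates_com ;; auction_com ''e'' ;; ''ve'' ::= var ''val'' ;; auction_com ''f'' ;;
        pick_com ;; commit_com) ?s1 (2 * ?A + 9 * ?m + 10) ?Q"
    proof (rule runs_seqI[OF runs_candidates[of ?s1 inp, OF e1(1) v1], where T' = "2 * ?A + 4 * ?m + 7"])
      fix s2 assume s2: "agree {''e'', ''f'', ''i''} ?s1 s2 \<and>
        ones inp (s2 ''e'') = insert (?s1 ''v'' 0) (ones inp (?s1 ''d'')) \<and>
        ones inp (s2 ''f'') = ones inp (?s1 ''d'') \<union> cg.nbrs inp (?s1 ''v'' 0)"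
      then have ag2: "agree {''e'', ''f'', ''i''} ?s1 s2" by blast
      have g2: "agree step_vars s s2" by (rule agree_trans[OF g1 ag2 sub(2)])
      have cur: "?s1 ''cur'' 0 = cg.opt inp ?D" using s1 by simp
      have e2: "s2 ''in'' = inp" "s2 ''h'' = s ''h''" "s2 ''cur'' 0 = cg.opt inp ?D"
        using agreeD[OF ag2, of "''in''"] agreeD[OF ag2, of "''h''"] agreeD[OF ag2, of "''cur''"]
          e1 cur by auto
      have f2: "ones inp (s2 ''e'') = insert ?v ?D" "ones inp (s2 ''f'') = ?D \<union> cg.nbrs inp ?v"
        using s2 e1 by metis+
      show "runs (auction_com ''e'' ;; ''ve'' ::= var ''val'' ;; auction_com ''f'' ;;
          pick_com ;; commit_com) s2 (2 * ?A + 4 * ?m + 7) ?Q"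
      proof (rule runs_seqI[OF runs_auction[of s2 inp "''e''", OF e2(1) nin(2)], where T' = "?A + 4 * ?m + 7"])
        fix s3 assume s3: "agree auction_vars s2 s3 \<and> s3 ''val'' 0 = cg.opt inp (ones inp (s2 ''e''))"
        let ?s3 = "s3(''ve'' := (s3 ''ve'')(0 := s3 ''val'' 0))"
        have g3: "agree step_vars s ?s3"
          using agree_trans[OF g2 conjunct1[OF s3] sub(1)] sub(6) by simp
        have e3: "?s3 ''in'' = inp" "?s3 ''h'' = s ''h''" "?s3 ''cur'' 0 = cg.opt inp ?D"
          "?s3 ''ve'' 0 = cg.opt inp (insert ?v ?D)"
          "?s3 ''e'' = s2 ''e''" "?s3 ''f'' = s2 ''f''"
          using s3 e2 f2 nin by (auto simp: agree_def)
        have "runs (auction_com ''f'' ;; pick_com ;; commit_com) ?s3 (?A + 4 * ?m + 6) ?Q"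
        proof (rule runs_seqI[OF runs_auction[of ?s3 inp "''f''", OF e3(1) nin(3)], where T' = "4 * ?m + 6"])
          fix s4 assume s4: "agree auction_vars ?s3 s4 \<and> s4 ''val'' 0 = cg.opt inp (ones inp (?s3 ''f''))"
          have g4: "agree step_vars s s4" by (rule agree_trans[OF g3 conjunct1[OF s4] sub(1)])
          have e4: "s4 ''in'' = inp" "s4 ''h'' = s ''h''" "s4 ''cur'' 0 = cg.opt inp ?D"
            "s4 ''ve'' 0 = cg.opt inp (insert ?v ?D)" "s4 ''e'' = s2 ''e''" "s4 ''f'' = s2 ''f''"
            using agreeD[OF conjunct1[OF s4]] nin e3 by metis+
          have val: "s4 ''val'' 0 = cg.opt inp (?D \<union> cg.nbrs inp ?v)"
            using s4 e3(6) f2(2) by metis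
          show "runs (pick_com ;; commit_com) s4 (4 * ?m + 6) ?Q"
          proof (rule runs_seqI[OF runs_pick, where T' = "4 * ?m + 2"])
            fix s5 assume s5: "agree {''pick'', ''h''} s4 s5 \<and>
              (s5 ''pick'' 0, s5 ''h'' 0) =
               (if s4 ''ve'' 0 = s4 ''cur'' 0 then (0, s4 ''h'' 0)
                else if s4 ''val'' 0 = s4 ''cur'' 0 then (1, s4 ''h'' 0)
                else (s4 ''h'' 0 mod 2, s4 ''h'' 0 div 2))"
            then have ag5: "agree {''pick'', ''h''} s4 s5" by blast
            have g5: "agree step_vars s s5" by (rule agree_trans[OF g4 ag5 sub(3)])
            have e5: "s5 ''in'' = inp" "ones inp (s5 ''e'') = insert ?v ?D"
              "ones inp (s5 ''f'') = ?D \<union> cg.nbrs inp ?v"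
              using agreeD[OF ag5, of "''in''"] agreeD[OF ag5, of "''e''"] agreeD[OF ag5, of "''f''"]
                e4 f2 by auto
            have p: "(s5 ''pick'' 0, s5 ''h'' 0) =
               (if cg.opt inp (insert ?v ?D) = cg.opt inp ?D then (0, s ''h'' 0)
                else if cg.opt inp (?D \<union> cg.nbrs inp ?v) = cg.opt inp ?D then (1, s ''h'' 0)
                else (s ''h'' 0 mod 2, s ''h'' 0 div 2))"
              using conjunct2[OF s5] unfolding e4 val .
            have dec: "((if 0 < s5 ''pick'' 0 then ?D \<union> cg.nbrs inp ?v else insert ?v ?D), s5 ''h'' 0)
              = cg.decide inp ?v (?D, s ''h'' 0)"
              using p unfolding cg.decide_def by (auto simp: odd_iff_mod_2_eq_one split: if_splits)
            show "runs commit_com s5 (4 * ?m + 2) ?Q"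
            proof (rule runs_mono[OF runs_commit[of s5 inp, OF e5(1)] order_refl], elim conjE, intro conjI)
              fix s6 assume a: "agree {''d'', ''i''} s5 s6"
                and d: "ones inp (s6 ''d'') = (if 0 < s5 ''pick'' 0 then ones inp (s5 ''f'') else ones inp (s5 ''e''))"
              show "agree step_vars s s6" by (rule agree_trans[OF g5 a sub(4)])
              have "s6 ''h'' = s5 ''h''" using agreeD[OF a] by simp
              then show "(ones inp (s6 ''d''), s6 ''h'' 0) = cg.decide inp ?v (?D, s ''h'' 0)"
                unfolding d e5 dec[symmetric] by simp
            qed
          qed simp
        qed simp
        then show "runs (''ve'' ::= var ''val'' ;; auction_com ''f'' ;; pick_com ;; commit_com) s3
            (?A + 4 * ?m + 7) ?Q"
          by (simp add: ac_simps)
      qed simp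
    qed simp
    then show "runs (''cur'' ::= var ''val'' ;; candidates_com ;; auction_com ''e'' ;; ''ve'' ::= var ''val'' ;;
       auction_com ''f'' ;; pick_com ;; commit_com) s1 (2 * ?A + 9 * ?m + 11) ?Q"
      by (simp add: ac_simps)
  qed (simp add: step_time_def)
qed

section \<open>One full branching path and the search over all guesses\<close>

definition run_com :: com where
  "run_com = ''h'' ::= var ''g'' ;; For ''i'' (Put ''d'' (var ''i'') (Const 0)) ;;
     For ''v'' step_com ;; auction_com ''d''"

definition run_vars :: "string set" where
  "run_vars = insert ''v'' step_vars"

definition run_time :: "nat \<Rightarrow> nat" where
  "run_time m = 3 * m + 5 + m * (step_time m + 2) + auction_time m"

text \<open>The guess is copied from \<open>g\<close> to \<open>h\<close> because a path consumes
  its bits, and \<open>d\<close> is cleared so that earlier rounds leave no trace. After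
  \<open>k\<close> vertices the store represents \<open>decide_all\<close> at
  \<open>k\<close>.\<close>

lemma runs_run:
  assumes inp: "s ''in'' = inp"
  shows "runs run_com s (run_time (inp 1)) (\<lambda>s'. agree run_vars s s' \<and>
     s' ''val'' 0 = cg.opt inp (fst (cg.decide_all inp (inp 1) (s ''g'' 0))))"
    (is "runs _ _ _ ?Q")
proof -
  let ?m = "inp 1" and ?g = "s ''g'' 0"
  let ?s = "s(''h'' := (s ''h'')(0 := ?g))"
  have vars: "''h'' \<in> run_vars" "''i'' \<in> run_vars" "''d'' \<in> run_vars" "''v'' \<in> run_vars"
    "step_vars \<subseteq> run_vars" "auction_vars \<subseteq> run_vars"
    "''in'' \<notin> step_vars" "''v'' \<notin> step_vars" "''in'' \<notin> run_vars"
    "''d'' \<notin> auction_vars"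
    by (auto simp: run_vars_def step_vars_def auction_vars_def)
  let ?Z = "\<lambda>k t. agree run_vars s t \<and> (\<forall>j<k. t ''d'' j = 0) \<and> t ''h'' 0 = ?g"
  let ?I = "\<lambda>k t. agree run_vars s t \<and> (ones inp (t ''d''), t ''h'' 0) = cg.decide_all inp k ?g"
  have "runs (For ''i'' (Put ''d'' (var ''i'') (Const 0))) ?s (3 * ?m + 2) (?Z ?m)"
    apply (rule runs_For[where I = ?Z and B = 1 and m = ?m])
    subgoal using vars by simp
    subgoal using inp by simp
    subgoal by simp
    subgoal using vars by (auto simp: less_Suc_eq)
    subgoal by simp
    subgoal by simp
    done
  then have "runs (For ''i'' (Put ''d'' (var ''i'') (Const 0)) ;; For ''v'' step_com ;; auction_com ''d'')
      ?s (run_time ?m - 1) ?Q"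
  proof (rule runs_seqI[where T' = "?m * (step_time ?m + 2) + 2 + auction_time ?m"])
    fix t assume t: "?Z ?m t"
    then have "ones inp (t ''d'') = {}" by (simp add: ones_def)
    moreover have "t ''in'' = inp" using t inp vars agreeD by metis
    ultimately have "runs (For ''v'' step_com) t (?m * (step_time ?m + 2) + 2) (?I ?m)"
      apply (intro runs_For[where I = ?I and B = "step_time ?m" and m = ?m])
      subgoal using t vars by simp
      subgoal by simp
      subgoal by simp
      subgoal premises p for k t'
      proof -
        have e: "t' ''in'' = inp" using p(6) inp vars agreeD by metis
        have v: "t' ''v'' 0 < inp 1" using p by simp
        show ?thesis
        proof (rule runs_mono[OF runs_step[of t' inp, OF e v] order_refl], elim conjE, intro conjI)
          fix u assume a: "agree step_vars t' u"
            and d: "(ones inp (u ''d''), u ''h'' 0) = cg.decide inp (t' ''v'' 0) (ones inp (t' ''d''), t' ''h'' 0)"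
          show "u ''in'' 1 = ?m" using agreeD[OF a vars(7)] e by simp
          show "u ''v'' 0 = k" using agreeD[OF a vars(8)] p by simp
          have "agree run_vars s u" by (rule agree_trans[OF conjunct1[OF p(6)] a vars(5)])
          then show "agree run_vars s (u(''v'' := (u ''v'')(0 := Suc k)))" using vars by simp
          have "(ones inp (u ''d''), u ''h'' 0) = cg.decide inp k (cg.decide_all inp k ?g)"
            using d p(5,6) by metis
          then show "(ones inp ((u(''v'' := (u ''v'')(0 := Suc k))) ''d''), (u(''v'' := (u ''v'')(0 := Suc k))) ''h'' 0)
              = cg.decide_all inp (Suc k) ?g" by simp
        qed
      qed
      subgoal by simp
      subgoal by simp
      done
    then show "runs (For ''v'' step_com ;; auction_com ''d'') t (?m * (step_time ?m + 2) + 2 + auction_time ?m) ?Q"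
    proof (rule runs_seqI[where T' = "auction_time ?m"])
      fix u assume u: "?I ?m u"
      then have "u ''in'' = inp" using inp vars agreeD by metis
      then have "runs (auction_com ''d'') u (auction_time ?m) (\<lambda>s'. agree auction_vars u s' \<and>
          s' ''val'' 0 = cg.opt inp (ones inp (u ''d'')))"
        using vars(10) by (rule runs_auction)
      then show "runs (auction_com ''d'') u (auction_time ?m) ?Q"
      proof (rule runs_mono[OF _ order_refl], elim conjE, intro conjI)
        fix w assume a: "agree auction_vars u w" and v: "w ''val'' 0 = cg.opt inp (ones inp (u ''d''))"
        show "agree run_vars s w" by (rule agree_trans[OF conjunct1[OF u] a vars(6)])
        have "ones inp (u ''d'') = fst (cg.decide_all inp ?m ?g)" using u by (metis fst_conv)
        then show "w ''val'' 0 = cg.opt inp (fst (cg.decide_all inp ?m ?g))" using v by simp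
      qed
    qed simp
  qed (simp add: run_time_def)
  then show ?thesis by (simp add: run_com_def)
qed

definition search_com :: com where
  "search_com = ''g'' ::= Const 0 ;; While (Less (var ''g'') (var ''B''))
     (run_com ;; Cond (Less (var ''r2'') (var ''val'')) Skip (''out'' ::= Const 1) ;;
      ''g'' ::= Add (var ''g'') (Const 1))"

text \<open>A success sets \<open>out\<close> for good, so at the end it records whether some guess
  met the budget.\<close>

lemma runs_search:
  assumes inp: "s ''in'' = inp" and out: "s ''out'' 0 = 0"
  shows "runs search_com s (s ''B'' 0 * (run_time (inp 1) + 4) + 2) (\<lambda>s'. s' ''out'' 0 \<noteq> 0 \<longleftrightarrow>
     (\<exists>h < s ''B'' 0. cg.opt inp (fst (cg.decide_all inp (inp 1) h)) \<le> s ''r2'' 0))"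
proof -
  let ?ok = "\<lambda>h. cg.opt inp (fst (cg.decide_all inp (inp 1) h)) \<le> s ''r2'' 0"
  let ?W = "run_vars \<union> {''g'', ''out''}"
  let ?I = "\<lambda>t. agree ?W s t \<and> t ''g'' 0 \<le> s ''B'' 0 \<and> (t ''out'' 0 \<noteq> 0 \<longleftrightarrow> (\<exists>h < t ''g'' 0. ?ok h))"
  have nin: "''in'' \<notin> ?W" "''r2'' \<notin> ?W" "''B'' \<notin> ?W" "''g'' \<notin> run_vars" "''out'' \<notin> run_vars"
    by (auto simp: run_vars_def step_vars_def auction_vars_def)
  have "runs (While (Less (var ''g'') (var ''B''))
     (run_com ;; Cond (Less (var ''r2'') (var ''val'')) Skip (''out'' ::= Const 1) ;;
      ''g'' ::= Add (var ''g'') (Const 1))) (s(''g'' := (s ''g'')(0 := 0)))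
     (s ''B'' 0 * (run_time (inp 1) + 4) + 1) (\<lambda>s'. s' ''out'' 0 \<noteq> 0 \<longleftrightarrow> (\<exists>h < s ''B'' 0. ?ok h))"
  proof (rule runs_while[where I = ?I and V = "\<lambda>t. s ''B'' 0 - t ''g'' 0" and B = "run_time (inp 1) + 3"])
    show "?I (s(''g'' := (s ''g'')(0 := 0)))" using out by simp
    fix t assume t: "?I t"
    have e: "t ''in'' = inp" "t ''r2'' = s ''r2''" "t ''B'' = s ''B''"
      using agreeD[OF conjunct1[OF t]] nin(1-3) inp by auto
    {
      assume "bval (Less (var ''g'') (var ''B'')) t"
      then have g: "t ''g'' 0 < s ''B'' 0" using e by simp
      show "runs (run_com ;; Cond (Less (var ''r2'') (var ''val'')) Skip (''out'' ::= Const 1) ;;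
          ''g'' ::= Add (var ''g'') (Const 1)) t (run_time (inp 1) + 3)
          (\<lambda>s'. ?I s' \<and> s ''B'' 0 - s' ''g'' 0 < s ''B'' 0 - t ''g'' 0)"
      proof (rule runs_seqI[OF runs_run[of t inp, OF e(1)], where T' = 3])
        fix u assume u: "agree run_vars t u \<and> u ''val'' 0 =
          cg.opt inp (fst (cg.decide_all inp (inp 1) (t ''g'' 0)))"
        have "agree ?W s u" by (rule agree_trans[OF conjunct1[OF t] conjunct1[OF u]]) blast
        moreover have "u ''g'' = t ''g''" "u ''out'' = t ''out''"
          using agreeD[OF conjunct1[OF u]] nin(4,5) by auto
        moreover have "u ''r2'' = s ''r2''" using agreeD[OF calculation(1) nin(2)] .
        moreover have "(\<exists>h < Suc n. ?ok h) \<longleftrightarrow> (\<exists>h<n. ?ok h) \<or> ?ok n" for n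
          using less_Suc_eq by auto
        ultimately show "runs (Cond (Less (var ''r2'') (var ''val'')) Skip (''out'' ::= Const 1) ;;
            ''g'' ::= Add (var ''g'') (Const 1)) u 3
            (\<lambda>s'. ?I s' \<and> s ''B'' 0 - s' ''g'' 0 < s ''B'' 0 - t ''g'' 0)"
          using u t g by simp
      qed simp
    next
      assume "\<not> bval (Less (var ''g'') (var ''B'')) t"
      then have "t ''g'' 0 = s ''B'' 0" using t e by simp
      then show "t ''out'' 0 \<noteq> 0 \<longleftrightarrow> (\<exists>h < s ''B'' 0. ?ok h)" using t by simp
    }
  qed simp
  then show ?thesis by (simp add: search_com_def)
qed

section \<open>The number of guesses and the main program\<close>

definition pow_com :: com where
  "pow_com = ''B'' ::= Const 1 ;; While (Less (Const 0) (var ''q''))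
     (''B'' ::= Add (var ''B'') (var ''B'') ;; ''q'' ::= Sub (var ''q'') (Const 1))"

lemma runs_pow:
  "runs pow_com s (s ''q'' 0 * 3 + 2) (\<lambda>s'. agree {''B'', ''q''} s s' \<and> s' ''B'' 0 = 2 ^ (s ''q'' 0))"
proof -
  let ?I = "\<lambda>t. agree {''B'', ''q''} s t \<and> t ''B'' 0 * 2 ^ (t ''q'' 0) = (2::nat) ^ (s ''q'' 0)"
  have "runs (While (Less (Const 0) (var ''q''))
     (''B'' ::= Add (var ''B'') (var ''B'') ;; ''q'' ::= Sub (var ''q'') (Const 1)))
     (s(''B'' := (s ''B'')(0 := 1))) (s ''q'' 0 * 3 + 1)
     (\<lambda>s'. agree {''B'', ''q''} s s' \<and> s' ''B'' 0 = 2 ^ (s ''q'' 0))"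
  proof (rule runs_while[where I = ?I and V = "\<lambda>t. t ''q'' 0" and B = 2])
    fix t assume t: "?I t" "bval (Less (Const 0) (var ''q'')) t"
    then obtain n where "t ''q'' 0 = Suc n" using gr0_implies_Suc by auto
    then show "runs (''B'' ::= Add (var ''B'') (var ''B'') ;; ''q'' ::= Sub (var ''q'') (Const 1)) t 2
        (\<lambda>s'. ?I s' \<and> s' ''q'' 0 < t ''q'' 0)"
      using t(1) by (simp add: algebra_simps)
  qed auto
  then show ?thesis by (simp add: pow_com_def)
qed

text \<open>The first test rejects \<open>k > m\<close>, where cut-off subtraction would pretend a
  budget of 0. The budget \<open>r2\<close> is doubled like the bound; if the bound of the empty set
  already exceeds it, no cover is small enough.\<close>

definition main_com :: com where
  "main_com = Cond (Less edge_count (Get ''in'' (Const 2))) Skip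
     (''r2'' ::= Add (Sub edge_count (Get ''in'' (Const 2))) (Sub edge_count (Get ''in'' (Const 2))) ;;
      auction_com ''d'' ;;
      Cond (Less (var ''r2'') (var ''val'')) Skip
       (''q'' ::= Sub (var ''r2'') (var ''val'') ;; pow_com ;; search_com))"

definition main_time :: "nat \<Rightarrow> nat" where
  "main_time m = auction_time m + run_time m + 14"

lemma runs_main:
  assumes inp: "s ''in'' = inp" and zero: "s ''out'' 0 = 0" "\<And>i. s ''d'' i = 0"
  defines "r2 \<equiv> 2 * (inp 1 - inp 2)"
  shows "runs main_com s (main_time (inp 1) * 2 ^ (r2 - cg.opt inp {}))
    (\<lambda>s'. s' ''out'' 0 \<noteq> 0 \<longleftrightarrow> inp 2 \<le> inp 1 \<and> (\<exists>S. cg.vcover inp S \<and> 2 * card S \<le> r2))"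
proof (cases "inp 1 < inp 2")
  case True
  have "2 \<le> main_time (inp 1) * 2 ^ (r2 - cg.opt inp {})"
    using mult_le_mono[of 2 "main_time (inp 1)" 1 "2 ^ (r2 - cg.opt inp {})"]
    by (simp add: main_time_def)
  then show ?thesis using True inp zero by (simp add: main_com_def)
next
  case False
  let ?m = "inp 1" and ?o = "cg.opt inp {}"
  let ?s = "s(''r2'' := (s ''r2'')(0 := r2))"
  let ?Q = "\<lambda>s'. s' ''out'' 0 \<noteq> 0 \<longleftrightarrow> (\<exists>S. cg.vcover inp S \<and> 2 * card S \<le> r2)"
  define q where "q = r2 - ?o"
  have nin: "''d'' \<notin> auction_vars" "''in'' \<notin> auction_vars" "''r2'' \<notin> auction_vars" "''out'' \<notin> auction_vars"
    by (auto simp: auction_vars_def)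
  have inp': "?s ''in'' = inp" and d: "ones inp (?s ''d'') = {}"
    using inp zero by (auto simp: ones_def)
  let ?T = "3 * q + 2 + (2 ^ q * (run_time ?m + 4) + 2)"
  have "runs (auction_com ''d'' ;; Cond (Less (var ''r2'') (var ''val'')) Skip
       (''q'' ::= Sub (var ''r2'') (var ''val'') ;; pow_com ;; search_com)) ?s
       (auction_time ?m + (?T + 2)) ?Q"
  proof (rule runs_seqI[OF runs_auction[of ?s inp "''d''", OF inp' nin(1)], unfolded d])
    fix t assume t: "agree auction_vars ?s t \<and> t ''val'' 0 = ?o"
    have e: "t ''in'' = inp" "t ''r2'' = ?s ''r2''" "t ''out'' = ?s ''out''"
      using inp' agreeD[OF conjunct1[OF t]] nin by metis+
    have r2: "t ''r2'' 0 = r2" and out: "t ''out'' 0 = 0" and val: "t ''val'' 0 = ?o"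
      using e t zero by auto
    show "runs (Cond (Less (var ''r2'') (var ''val'')) Skip
       (''q'' ::= Sub (var ''r2'') (var ''val'') ;; pow_com ;; search_com)) t (?T + 2) ?Q"
    proof (cases "r2 < ?o")
      case True
      have "\<not> (\<exists>S. cg.vcover inp S \<and> 2 * card S \<le> r2)"
      proof
        assume "\<exists>S. cg.vcover inp S \<and> 2 * card S \<le> r2"
        then obtain S where S: "cg.vcover inp S" "2 * card S \<le> r2" by blast
        from cg.opt_le_vcover[OF S(1) empty_subsetI] S(2) True show False by linarith
      qed
      then show ?thesis using True r2 out val by simp
    next
      case False
      let ?t = "t(''q'' := (t ''q'')(0 := q))"
      have "runs (pow_com ;; search_com) ?t ?T ?Q"
      proof (rule runs_seqI[OF runs_pow])
        fix u assume "agree {''B'', ''q''} ?t u \<and> u ''B'' 0 = 2 ^ (?t ''q'' 0)"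
        then have ag: "agree {''B'', ''q''} ?t u" and B: "u ''B'' 0 = 2 ^ q" by auto
        have u: "u ''in'' = inp" "u ''out'' 0 = 0" "u ''r2'' 0 = r2"
          using agreeD[OF ag] e out r2 by auto
        show "runs search_com u (2 ^ q * (run_time ?m + 4) + 2) ?Q"
          using runs_search[of u inp, OF u(1,2)] cg.decide_all_correct[of r2 inp]
          unfolding B u(3) q_def by simp
      qed simp
      then show ?thesis using False r2 val unfolding q_def by simp
    qed
  qed simp
  then have "runs main_com s (auction_time ?m + (?T + 2) + 2) ?Q"
    using False inp by (simp add: main_com_def r2_def mult_2)
  \<comment> \<open>As \<open>q < 2 ^ q\<close>, the term \<open>3 * q\<close> and the constants are
    absorbed by \<open>14 * 2 ^ q\<close>.\<close>
  moreover have "auction_time ?m + (?T + 2) + 2 \<le> main_time ?m * 2 ^ q"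
  proof -
    have "q < 2 ^ q" by (rule less_exp)
    moreover have "auction_time ?m \<le> auction_time ?m * 2 ^ q"
      using mult_le_mono2[of 1 "2 ^ q" "auction_time ?m"] by simp
    moreover have "main_time ?m * 2 ^ q = auction_time ?m * 2 ^ q + run_time ?m * 2 ^ q + 14 * 2 ^ q"
      "2 ^ q * (run_time ?m + 4) = run_time ?m * 2 ^ q + 4 * 2 ^ q"
      by (simp_all add: main_time_def algebra_simps)
    ultimately show ?thesis by linarith
  qed
  ultimately show ?thesis using False unfolding q_def by (auto elim: runs_mono)
qed

text \<open>Two doublings of \<open>out\<close> per round replace the missing multiplication by
  4.\<close>

lemma computable_power4: "computable (\<lambda>n. 4 ^ n)"
proof -
  let ?body = "''out'' ::= Add (var ''out'') (var ''out'') ;; ''out'' ::= Add (var ''out'') (var ''out'') ;;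
     ''x'' ::= Sub (var ''x'') (Const 1)"
  let ?p = "''out'' ::= Const 1 ;; ''x'' ::= var ''in'' ;; While (Less (Const 0) (var ''x'')) ?body"
  have "runs ?p (init_store [n]) (n * 4 + 3) (\<lambda>s. result s = 4 ^ n)" for n
  proof -
    let ?I = "\<lambda>t. t ''out'' 0 * 4 ^ (t ''x'' 0) = (4::nat) ^ n"
    let ?s = "(init_store [n])(''out'' := (init_store [n] ''out'')(0 := 1))"
    have "runs (While (Less (Const 0) (var ''x'')) ?body) (?s(''x'' := (?s ''x'')(0 := n)))
       (n * 4 + 1) (\<lambda>s. result s = 4 ^ n)"
    proof (rule runs_while[where I = ?I and V = "\<lambda>t. t ''x'' 0" and B = 3])
      fix t assume t: "?I t" "bval (Less (Const 0) (var ''x'')) t"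
      then obtain k where "t ''x'' 0 = Suc k" using gr0_implies_Suc by auto
      then show "runs ?body t 3 (\<lambda>s'. ?I s' \<and> s' ''x'' 0 < t ''x'' 0)"
        using t(1) by (simp add: algebra_simps)
    qed (auto simp: result_def)
    then show ?thesis by (simp add: init_store_def)
  qed
  then show ?thesis unfolding computable_def runs_def by blast
qed

section \<open>Instances of Colored Clustering\<close>

lemma auction_time_le: "auction_time m \<le> 18 * Suc m ^ 3"
proof -
  have "m * Suc m + m \<le> Suc m ^ 2" by (simp add: power2_eq_square)
  moreover have "5 * m + 12 \<le> 12 * Suc m" by simp
  ultimately have "(m * Suc m + m) * (5 * m + 12) \<le> Suc m ^ 2 * (12 * Suc m)" by (rule mult_le_mono)
  also have "\<dots> = 12 * Suc m ^ 3" by (simp add: power2_eq_square power3_eq_cube algebra_simps)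
  finally have "auction_time m \<le> 6 * Suc m + 12 * Suc m ^ 3" by (simp add: auction_time_def)
  moreover have "Suc m ^ 1 \<le> Suc m ^ 3" by (rule power_increasing) auto
  ultimately show ?thesis by simp
qed

text \<open>A path takes \<open>O(m)\<close> auctions of cubic cost. Passing to degree 5 leaves room
  for the factor \<open>243 = 3 ^ 5\<close>, so the bound is a power of \<open>3 * m + 3\<close>,
  which the length of an input word reaches.\<close>

lemma main_time_le: "main_time m \<le> (3 * m + 3) ^ 5"
proof -
  define M where "M = Suc m"
  have pow: "M ^ i \<le> M ^ j" if "i \<le> j" for i j
    using that by (intro power_increasing) (auto simp: M_def)
  have M: "m \<le> M" "M = m + 1" by (auto simp: M_def)
  have p3: "1 \<le> M ^ 3" "M \<le> M ^ 3" using pow[of 0 3] pow[of 1 3] by auto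
  have p4: "1 \<le> M ^ 4" "M \<le> M ^ 4" "M ^ 3 \<le> M ^ 4" "M ^ 4 \<le> M ^ 5"
    using pow[of 0 4] pow[of 1 4] pow[of 3 4] pow[of 4 5] by auto
  have a: "auction_time m \<le> 18 * M ^ 3" using auction_time_le[of m] by (simp only: M_def)
  \<comment> \<open>With \<open>m = M - 1\<close> the lower terms are \<open>9 * M + 4\<close>, and
    \<open>3 * 18 + 9 + 4 = 67\<close>.\<close>
  have "step_time m + 2 \<le> 67 * M ^ 3"
    using a p3 M unfolding step_time_def by linarith
  then have "m * (step_time m + 2) \<le> M * (67 * M ^ 3)" using M(1) by (rule mult_le_mono[rotated])
  also have "\<dots> = 67 * M ^ 4" by (simp add: power4_eq_xxxx power3_eq_cube)
  finally have "run_time m \<le> 90 * M ^ 4"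
    using a p4 M unfolding run_time_def by linarith
  then have "main_time m \<le> 243 * M ^ 5"
    using a p4 unfolding main_time_def by linarith
  also have "\<dots> = (3 * M) ^ 5" by (simp add: power_mult_distrib)
  finally show ?thesis by (simp add: M_def algebra_simps)
qed

lemma length_le_word_size: "length w \<le> word_size w"
proof -
  have pos: "1 \<le> bit_length n" for n by (subst bit_length.simps) simp
  have "length w \<le> sum_list (map bit_length w)"
  proof (induction w)
    case (Cons a w)
    then show ?case using pos[of a] by simp
  qed simp
  then show ?thesis by (simp add: word_size_def)
qed

lemma concat_triples_nth:
  assumes "i < length xs" "r < 3" "\<And>x. length (f x) = 3"
  shows "concat (map f xs) ! (3 * i + r) = f (xs ! i) ! r"
  using assms(1)
proof (induction xs arbitrary: i)
  case (Cons x xs)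
  then show ?case using assms(2,3) by (cases i) (auto simp: nth_append)
qed simp

section \<open>From an input word to its conflict graph\<close>

locale encoded_instance =
  fixes V :: "nat set" and E :: "nat set set" and C :: "nat set" and l :: "nat set \<Rightarrow> nat"
    and k :: nat and vs :: "nat list" and es :: "(nat \<times> nat) list" and w :: "nat list"
  assumes inst: "(V, E, C, l, k) \<in> cc_instances"
    and distinct_es: "distinct (map (\<lambda>(u, v). {u, v}) es)"
    and set_es: "set (map (\<lambda>(u, v). {u, v}) es) = E"
    and w_def: "w = [length vs, length es, k] @ vs @ concat (map (\<lambda>(u, v). [u, v, l {u, v}]) es)"
begin

abbreviation inp :: "nat \<Rightarrow> nat" where
  "inp \<equiv> init_store w ''in''"

abbreviation m :: nat where
  "m \<equiv> length es"

definition edge :: "nat \<Rightarrow> nat set" where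
  "edge i = {fst (es ! i), snd (es ! i)}"

lemma length_w: "length w = 3 + length vs + 3 * m"
proof -
  have "length (concat (map (\<lambda>(u, v). [u, v, l {u, v}]) es)) = 3 * m"
    by (induction es) auto
  then show ?thesis by (simp add: w_def)
qed

lemma inp_header: "inp 0 = length vs" "inp 1 = m" "inp 2 = k"
  by (simp_all add: init_store_def length_w) (simp_all add: w_def)

lemma inp_edge:
  assumes "i < m" "r < 3"
  shows "inp (r + 3 + inp 0 + (i + (i + i))) = [fst (es ! i), snd (es ! i), l (edge i)] ! r"
proof -
  let ?f = "\<lambda>(u, v). [u, v, l {u, v}]"
  have idx: "r + 3 + inp 0 + (i + (i + i)) = 3 + (length vs + (3 * i + r))"
    using inp_header(1) by simp
  have "inp (r + 3 + inp 0 + (i + (i + i))) = w ! (3 + (length vs + (3 * i + r)))"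
    unfolding idx using assms by (simp add: init_store_def length_w)
  also have "\<dots> = concat (map ?f es) ! (3 * i + r)"
    by (simp add: w_def nth_append)
  also have "\<dots> = ?f (es ! i) ! r"
    using assms by (intro concat_triples_nth) auto
  finally show ?thesis by (simp add: edge_def case_prod_beta)
qed

lemma fields:
  assumes "i < m"
  shows "src inp i = fst (es ! i)" "tgt inp i = snd (es ! i)" "col inp i = l (edge i)"
  using inp_edge[OF assms, of 0] inp_edge[OF assms, of 1] inp_edge[OF assms, of 2]
  by (simp_all add: src_def tgt_def col_def)

lemma conflict_iff:
  assumes "i < m" "j < m"
  shows "conflict inp i j \<longleftrightarrow> l (edge i) \<noteq> l (edge j) \<and> edge i \<inter> edge j \<noteq> {}"
  using assms by (auto simp: conflict_def fields edge_def)

text \<open>Distinctness is demanded of the unordered pairs, so an edge cannot be listed again with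
  its ends reversed.\<close>

lemma bij_edge: "bij_betw edge {..<m} E"
proof -
  have e: "edge i = map (\<lambda>(u, v). {u, v}) es ! i" if "i < m" for i
    using that by (simp add: edge_def case_prod_beta)
  show ?thesis
    unfolding bij_betw_def
  proof
    show "inj_on edge {..<m}"
    proof (rule inj_onI)
      fix i j assume ij: "i \<in> {..<m}" "j \<in> {..<m}" "edge i = edge j"
      then have "map (\<lambda>(u, v). {u, v}) es ! i = map (\<lambda>(u, v). {u, v}) es ! j"
        using e by simp
      then show "i = j" using ij nth_eq_iff_index_eq[OF distinct_es] by simp
    qed
    have "edge ` {..<m} = (\<lambda>i. map (\<lambda>(u, v). {u, v}) es ! i) ` {..<m}"
      using e by (intro image_cong) auto
    also have "\<dots> = E"
      unfolding set_es[symmetric] by (force simp: set_conv_nth simp del: set_map)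
    finally show "edge ` {..<m} = E" .
  qed
qed

lemma card_edges: "card {e \<in> E. P e} = card {i. i < m \<and> P (edge i)}"
proof -
  have "inj_on edge {i. i < m \<and> P (edge i)}"
    using bij_edge by (auto simp: bij_betw_def inj_on_def)
  moreover have "edge ` {i. i < m \<and> P (edge i)} = {e \<in> E. P e}"
    using bij_edge by (auto simp: bij_betw_def)
  ultimately show ?thesis using card_image by fastforce
qed

lemma card_E: "card E = m"
  using bij_betw_same_card[OF bij_edge] by simp

text \<open>Complementation exchanges stable sets and covers. The conjunct \<open>k \<le> m\<close>
  is explicit because \<open>m - k\<close> is cut off.\<close>

lemma colored_clustering_iff:
  "colored_clustering (V, E, C, l, k) \<longleftrightarrow>
     k \<le> m \<and> (\<exists>S. cg.vcover inp S \<and> 2 * card S \<le> 2 * (m - k))"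
proof
  assume "colored_clustering (V, E, C, l, k)"
  then obtain F where F: "F \<subseteq> E" "stable l F" "k \<le> card F"
    by (auto simp: colored_clustering_def)
  let ?I = "{i. i < m \<and> edge i \<in> F}" and ?S = "{i. i < m \<and> edge i \<notin> F}"
  have "{e \<in> E. e \<in> F} = F" using F(1) by auto
  then have I: "card ?I = card F" using card_edges[of "\<lambda>e. e \<in> F"] by simp
  have "?S = {..<m} - ?I" by auto
  moreover have "card ({..<m} - ?I) = card {..<m} - card ?I" by (rule card_Diff_subset) auto
  ultimately have S: "card ?S = m - card F" using I by simp
  have "card ?I \<le> card {..<m}" by (rule card_mono) auto
  then have "card F \<le> m" using I by simp
  moreover have "cg.vcover inp ?S"
    using F(2) unfolding cg.vcover_def unfolding inp_header stable_def
    by (auto simp: conflict_iff)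
  ultimately show "k \<le> m \<and> (\<exists>S. cg.vcover inp S \<and> 2 * card S \<le> 2 * (m - k))"
    using F(3) S by (intro conjI exI[of _ ?S]) auto
next
  assume "k \<le> m \<and> (\<exists>S. cg.vcover inp S \<and> 2 * card S \<le> 2 * (m - k))"
  then obtain S where S: "k \<le> m" "cg.vcover inp S" "card S \<le> m - k" by auto
  let ?F = "edge ` ({..<m} - S)"
  have SM: "S \<subseteq> {..<m}" using S(2) unfolding cg.vcover_def unfolding inp_header by simp
  have "inj_on edge ({..<m} - S)" using bij_edge by (auto simp: bij_betw_def inj_on_def)
  then have "card ?F = m - card S"
    using SM by (simp add: card_image card_Diff_subset finite_subset[OF SM])
  then have "k \<le> card ?F" using S by simp
  moreover have "?F \<subseteq> E" using bij_edge by (auto simp: bij_betw_def)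
  moreover have "stable l ?F"
    unfolding stable_def
  proof (intro ballI impI)
    fix e e' assume "e \<in> ?F" "e' \<in> ?F" and ne: "e \<inter> e' \<noteq> {}"
    then obtain i j where ij: "i < m" "i \<notin> S" "e = edge i" "j < m" "j \<notin> S" "e' = edge j" by auto
    then have "\<not> conflict inp i j" using S(2) unfolding cg.vcover_def unfolding inp_header by blast
    then show "l e = l e'" using ij ne by (simp add: conflict_iff)
  qed
  ultimately show "colored_clustering (V, E, C, l, k)" by (auto simp: colored_clustering_def)
qed

section \<open>The bound by \<open>rho'\<close> and the parameter\<close>

text \<open>
  A half-integral cover that vanishes on some edge at \<open>v\<close> is full on every edge of another color
  at \<open>v\<close>; otherwise it is at least one half on all edges at \<open>v\<close>. Values are doubled.
\<close>

lemma local_bound: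
  assumes x: "cg.hcover inp {} x"
  shows "2 * min (real (deg E v) - real (Max ((\<lambda>c. col_deg E l c v) ` C))) (1/2 * real (deg E v))
    \<le> real (\<Sum>i | i < m \<and> v \<in> edge i. x i)"
proof -
  let ?I = "{i. i < m \<and> v \<in> edge i}" and ?X = "Max ((\<lambda>c. col_deg E l c v) ` C)"
  have deg: "deg E v = card ?I" unfolding deg_def by (rule card_edges)
  show ?thesis
  proof (cases "\<exists>i\<in>?I. x i = 0")
    case False
    then have "(\<Sum>i\<in>?I. 1) \<le> sum x ?I" by (intro sum_mono) (simp add: Suc_le_eq)
    then have "card ?I \<le> sum x ?I" by simp
    then have le: "real (card ?I) \<le> real (sum x ?I)" by (rule of_nat_mono)
    have "2 * min (real (card ?I) - real ?X) (1/2 * real (card ?I)) \<le> 2 * (1/2 * real (card ?I))"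
      by (intro mult_left_mono min.cobounded2) simp
    also have "\<dots> \<le> real (sum x ?I)" using le by simp
    finally show ?thesis unfolding deg .
  next
    case True
    then obtain i where i: "i < m" "v \<in> edge i" "x i = 0" by auto
    let ?c = "l (edge i)"
    let ?J = "{j. j < m \<and> v \<in> edge j \<and> l (edge j) = ?c}"
    have cd: "col_deg E l ?c v = card ?J" unfolding col_deg_def by (rule card_edges)
    have "edge i \<in> E" using bij_edge i by (auto simp: bij_betw_def)
    then have "?c \<in> C" using inst by (auto simp: cc_instances_def)
    \<comment> \<open>Also for infinite \<open>C\<close> the maximum is over a finite set, since all
      color degrees are at most \<open>deg E v\<close>.\<close>
    moreover have "finite ((\<lambda>c. col_deg E l c v) ` C)"
    proof (rule finite_subset)
      have "finite E" using bij_edge by (metis bij_betw_finite finite_lessThan)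
      then show "(\<lambda>c. col_deg E l c v) ` C \<subseteq> {..deg E v}"
        by (auto simp: col_deg_def deg_def intro!: card_mono)
    qed simp
    ultimately have mx: "card ?J \<le> Max ((\<lambda>c. col_deg E l c v) ` C)"
      unfolding cd[symmetric] by (intro Max_ge) auto
    have "2 * card (?I - ?J) = (\<Sum>j\<in>?I - ?J. 2)" by simp
    also have "\<dots> \<le> (\<Sum>j\<in>?I - ?J. x j)"
    proof (rule sum_mono)
      fix j assume j: "j \<in> ?I - ?J"
      then have "conflict inp i j" using i by (auto simp: conflict_iff)
      then have "2 \<le> x i + x j" using x i(1) j unfolding cg.hcover_def unfolding inp_header by blast
      then show "2 \<le> x j" using i by simp
    qed
    also have "\<dots> \<le> sum x ?I" by (rule sum_mono2) auto
    finally have "2 * (card ?I - card ?J) \<le> sum x ?I"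
      by (subst (asm) card_Diff_subset) auto
    moreover have "2 * (real a - real b) \<le> real c" if "2 * (a - b) \<le> c" for a b c :: nat
    proof -
      have "2 * a \<le> c + 2 * b" using that by simp
      then have "real (2 * a) \<le> real (c + 2 * b)" by (rule of_nat_mono)
      then show ?thesis by simp
    qed
    ultimately have le: "2 * (real (card ?I) - real (card ?J)) \<le> real (sum x ?I)" by blast
    have "2 * min (real (card ?I) - real ?X) (1/2 * real (card ?I)) \<le> 2 * (real (card ?I) - real ?X)"
      by (intro mult_left_mono min.cobounded1) simp
    also have "\<dots> \<le> 2 * (real (card ?I) - real (card ?J))" using mx by simp
    also note le
    finally show ?thesis unfolding deg .
  qed
qed

text \<open>Sum the local bounds over \<open>V\<close> and exchange the sums: each edge has exactly
  two ends in \<open>V\<close>, so the total is twice the optimal value.\<close>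

lemma rho'_le_opt: "2 * rho' V E C l \<le> real (cg.opt inp {})"
proof -
  obtain x where x: "cg.hcover inp {} x" "sum x {..<m} = cg.opt inp {}"
    using cg.opt_attained[of inp "{}"] unfolding inp_header by blast
  have V: "finite V" and sub: "E \<subseteq> {{u, v} | u v. u \<in> V \<and> v \<in> V \<and> u \<noteq> v}"
    using inst by (auto simp: cc_instances_def simple_graph_def)
  have E: "e \<subseteq> V \<and> card e = 2" if e: "e \<in> E" for e
  proof -
    obtain u v where "e = {u, v}" "u \<in> V" "v \<in> V" "u \<noteq> v" using sub e by blast
    then show ?thesis by simp
  qed
  \<comment> \<open>The factor 4 cancels the one half in \<open>rho'\<close> and supplies the 2 of
    \<open>local_bound\<close>.\<close>
  have "4 * rho' V E C l = (\<Sum>v\<in>V. 2 * min (real (deg E v) -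
      real (Max ((\<lambda>c. col_deg E l c v) ` C))) (1/2 * real (deg E v)))"
    by (simp add: rho'_def sum_distrib_left)
  also have "\<dots> \<le> (\<Sum>v\<in>V. real (\<Sum>i | i < m \<and> v \<in> edge i. x i))"
    using local_bound[OF x(1)] by (intro sum_mono)
  also have "\<dots> = real (\<Sum>v\<in>V. \<Sum>i | i < m \<and> v \<in> edge i. x i)" by simp
  also have "(\<Sum>v\<in>V. \<Sum>i | i < m \<and> v \<in> edge i. x i) = (\<Sum>v\<in>V. \<Sum>i<m. if v \<in> edge i then x i else 0)"
    by (rule sum.cong[OF refl]) (simp add: sum.If_cases Int_def)
  also have "\<dots> = (\<Sum>i<m. \<Sum>v\<in>V. if v \<in> edge i then x i else 0)" by (rule sum.swap)
  also have "\<dots> = (\<Sum>i<m. 2 * x i)"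
  proof (rule sum.cong[OF refl])
    fix i assume "i \<in> {..<m}"
    then have "edge i \<in> E" using bij_edge by (auto simp: bij_betw_def)
    then have e: "V \<inter> edge i = edge i" "card (edge i) = 2" using E by auto
    show "(\<Sum>v\<in>V. if v \<in> edge i then x i else 0) = 2 * x i"
      using V e by (simp add: sum.If_cases)
  qed
  also have "\<dots> = 2 * cg.opt inp {}" using x(2) by (simp add: sum_distrib_left[symmetric])
  finally show ?thesis by simp
qed

lemma runs_instance:
  "runs main_com (init_store w)
     (4 ^ nat \<lceil>(real (card E) - real k) - rho' V E C l\<rceil> * word_size w ^ 5)
     (\<lambda>s. result s \<noteq> 0 \<longleftrightarrow> colored_clustering (V, E, C, l, k))"
proof (rule runs_mono)
  let ?par = "(real (card E) - real k) - rho' V E C l"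
  show "runs main_com (init_store w) (main_time m * 2 ^ (2 * (m - k) - cg.opt inp {}))
    (\<lambda>s. s ''out'' 0 \<noteq> 0 \<longleftrightarrow> k \<le> m \<and> (\<exists>S. cg.vcover inp S \<and> 2 * card S \<le> 2 * (m - k)))"
    using runs_main[of "init_store w" inp] unfolding inp_header by (simp add: init_store_def)
  \<comment> \<open>Rounding up only enlarges the exponent. If the parameter is not positive, or
    \<open>k > m\<close>, the left side is 0.\<close>
  have "2 * (m - k) - cg.opt inp {} \<le> 2 * nat \<lceil>?par\<rceil>"
    using rho'_le_opt unfolding card_E by linarith
  then have "(2::nat) ^ (2 * (m - k) - cg.opt inp {}) \<le> 2 ^ (2 * nat \<lceil>?par\<rceil>)"
    by (rule power_increasing) simp
  also have "\<dots> = 4 ^ nat \<lceil>?par\<rceil>" by (simp add: power_mult)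
  finally have "2 ^ (2 * (m - k) - cg.opt inp {}) \<le> (4::nat) ^ nat \<lceil>?par\<rceil>" .
  moreover have "main_time m \<le> word_size w ^ 5"
    using length_le_word_size[of w] length_w
    by (intro order.trans[OF main_time_le] power_mono) auto
  ultimately show "main_time m * 2 ^ (2 * (m - k) - cg.opt inp {}) \<le> 4 ^ nat \<lceil>?par\<rceil> * word_size w ^ 5"
    by (subst mult.commute) (rule mult_le_mono)
qed (simp add: result_def colored_clustering_iff)

end

theorem theorem3:
  shows "fixed_parameter_tractable cc_instances cc_encodes colored_clustering
    (\<lambda>(V, E, C, l, k). (real (card E) - real k) - rho' V E C l)"
  unfolding fixed_parameter_tractable_def
\<comment> \<open>Two bits per unit of the parameter give the base 4; the exponent 5 is that of
  \<open>main_time_le\<close>.\<close>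
proof (rule exI[of _ main_com], rule exI[of _ "\<lambda>n. 4 ^ n"], rule exI[of _ 5],
    intro conjI ballI allI impI)
  show "computable (\<lambda>n. 4 ^ n)" by (rule computable_power4)
  fix x w assume x: "x \<in> cc_instances" "cc_encodes x w"
  obtain V E C l k where xe: "x = (V, E, C, l, k)" by (cases x)
  obtain vs es where "encoded_instance V E C l k vs es w"
    using x unfolding xe cc_encodes_def encoded_instance_def by auto
  then show "\<exists>t s. exec main_com (init_store w) t s \<and>
      t \<le> 4 ^ nat \<lceil>case x of (V, E, C, l, k) \<Rightarrow> (real (card E) - real k) - rho' V E C l\<rceil> * word_size w ^ 5 \<and>
      (result s \<noteq> 0 \<longleftrightarrow> colored_clustering x)"
    unfolding xe prod.case runs_def[symmetric] by (rule encoded_instance.runs_instance)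
qed

end
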